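(* Let $F=\alpha\,\Psi(s,\bar s)$, with $s=\beta/\alpha$ and $\bar s=\gamma/\alpha$, be an $(\alpha,\beta,\gamma)$-metric on an open subset $\mathcal U\subseteq\mathbb R^n$. Then $F$ is projectively flat on $\mathcal U$ if and only if $$ {}^{\alpha}h_{ij}\,{}^{\alpha}G^i+\frac{\alpha}{\Pi}\Big[\Psi_s\,{}^{\beta}s_{j0}+\Psi_{\bar s}\,{}^{\gamma}s_{j0}\Big]+\frac{1}{2\Gamma}\Big[\Gamma_1h_j+\Gamma_2\bar h_j\Big]=0 .$$
   Context: Finsler metric: a function $F:TM\to[0,\infty)$, $C^\infty$ on $TM\setminus\{0\}$, positively 1-homogeneous in $y$, with $g_{ij}=\frac12[F^2]_{y^iy^j}$ positive definite for $y\neq0$. A Finsler metric on an open set $\mathcal U\subseteq\mathbb R^n$ is projectively flat if all its geodesics are straight (lines, as point sets) in $\mathcal U$; equivalently, its spray coefficients $G^i=\frac14 g^{il}\{\partial_{x^k}g_{jl}+\partial_{x^j}g_{lk}-\partial_{x^l}g_{jk}\}y^jy^k$ satisfy $G^i=P(x,y)y^i$ for some scalar function $P$. $(\alpha,\beta,\gamma)$-metric: $\alpha=\sqrt{a_{ij}(x)y^iy^j}$ is a Riemannian metric, $\beta=b_i(x)y^i$ and $\gamma=\gamma_i(x)y^i$ are 1-forms with $\|\beta\|_\alpha<b_0$, $\|\gamma\|_\alpha<g_0$, $\Psi(s,\bar s)$ is a positive $C^\infty$ function on $(-b_0,b_0)\times(-g_0,g_0)$, and $F=\alpha\Psi(\beta/\alpha,\gamma/\alpha)$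 is a Finsler metric. Subscripts $s,\bar s$ on $\Psi$ denote partial derivatives. Indices are raised and lowered with $a_{ij}$; $\alpha_i=\alpha_{y^i}$, $h_i=b_i-s\alpha_i$, $\bar h_i=\gamma_i-\bar s\alpha_i$, ${}^{\alpha}h_{ij}=a_{ij}-\alpha_i\alpha_j$, and ${}^\alpha G^i$ are the spray coefficients of $\alpha$. Put $b^2=a^{ij}b_ib_j$, $g^2=a^{ij}\gamma_i\gamma_j$, $\theta=a^{ij}b_i\gamma_j$, and $$\Pi=\Psi-s\Psi_s-\bar s\Psi_{\bar s},\qquad J=\frac{\Psi_{ss}\Psi_{\bar s\bar s}-\Psi_{s\bar s}^2}{\Pi},$$ $$\Gamma=\Pi+(b^2-s^2)\Psi_{ss}+(g^2-\bar s^2)\Psi_{\bar s\bar s}+2(\theta-s\bar s)\Psi_{s\bar s}+\big[(b^2-s^2)(g^2-\bar s^2)-(\theta-s\bar s)^2\big]J .$$ Expressions with $\Pi$ or $\Gamma$ in a denominator presuppose these are nonzero. With $|$ the Levi-Civita covariant derivative of $\alpha$: ${}^\beta r_{ij}=\frac12(b_{i|j}+b_{j|i})$, ${}^\beta s_{ij}=\frac12(b_{i|j}-b_{j|i})$, ${}^\gamma r_{ij}=\frac12(\gamma_{i|j}+\gamma_{j|i})$, ${}^\gamma s_{ij}=\frac12(\gamma_{i|j}-\gamma_{j|i})$. A lower index $0$ means contraction with $y$: ${}^\beta r_{00}={}^\beta r_{ij}y^iy^j$, ${}^\gamma r_{00}={}^\gamma r_{ij}y^iy^j$, ${}^\beta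 s_{i0}={}^\beta s_{ij}y^j$, ${}^\gamma s_{i0}={}^\gamma s_{ij}y^j$, ${}^\beta s^i_0=a^{ij}\,{}^\beta s_{j0}$, ${}^\gamma s^i_0=a^{ij}\,{}^\gamma s_{j0}$. Further, ${}^\beta s_0=b^i\,{}^\beta s_{i0}$, ${}^\beta\bar s_0=\gamma_i\,{}^\beta s^i_0$, ${}^\gamma s_0=\gamma^i\,{}^\gamma s_{i0}$, ${}^\gamma\bar s_0=b_i\,{}^\gamma s^i_0$. Finally $$\mathcal R^\beta={}^\beta r_{00}-\frac{2\alpha}{\Pi}\big[\Psi_s\,{}^\beta s_0+\Psi_{\bar s}\,{}^\gamma\bar s_0\big],\qquad \mathcal R^\gamma={}^\gamma r_{00}-\frac{2\alpha}{\Pi}\big[\Psi_s\,{}^\beta\bar s_0+\Psi_{\bar s}\,{}^\gamma s_0\big],$$ $$\Gamma_1=[\Psi_{ss}+(g^2-\bar s^2)J]\mathcal R^\beta+[\Psi_{s\bar s}-(\theta-s\bar s)J]\mathcal R^\gamma,$$ $$\Gamma_2=[\Psi_{\bar s\bar s}+(b^2-s^2)J]\mathcal R^\gamma+[\Psi_{s\bar s}-(\theta-s\bar s)J]\mathcal R^\beta .$$ *)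

theory Defs
  imports "HOL-Analysis.Analysis"
begin

section \<open>Partial derivatives and smoothness\<close>

definition pd :: "'n::finite \<Rightarrow> (real^'n \<Rightarrow> real) \<Rightarrow> real^'n \<Rightarrow> real" where
  "pd k f x = frechet_derivative f (at x) (axis k 1)"

fun k_smooth_on :: "nat \<Rightarrow> 'a::real_normed_vector set \<Rightarrow> ('a \<Rightarrow> 'b::real_normed_vector) \<Rightarrow> bool" where
  "k_smooth_on 0 S f \<longleftrightarrow> continuous_on S f"
| "k_smooth_on (Suc k) S f \<longleftrightarrow>
     (\<forall>x\<in>S. f differentiable (at x)) \<and>
     (\<forall>v. k_smooth_on k S (\<lambda>x. frechet_derivative f (at x) v))"

text \<open>Meant for open \<open>S\<close> only: the derivatives are taken in the ambient space.\<close>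

definition smooth_on :: "'a::real_normed_vector set \<Rightarrow> ('a \<Rightarrow> 'b::real_normed_vector) \<Rightarrow> bool" where
  "smooth_on S f \<longleftrightarrow> (\<forall>k. k_smooth_on k S f)"

section \<open>Finsler metrics on subsets of $R^n$\<close>

text \<open>\<open>F x y\<close> is the value on the tangent vector \<open>y\<close> at the point \<open>x\<close>.\<close>

definition fundamental_tensor ::
    "(real^'n \<Rightarrow> real^'n \<Rightarrow> real) \<Rightarrow> real^'n \<Rightarrow> real^'n \<Rightarrow> real^'n^'n" where
  "fundamental_tensor F x y =
     (\<chi> i j. 1/2 * pd j (\<lambda>w. pd i (\<lambda>v. (F x v)\<^sup>2) w) y)"

definition finsler_metric_on :: "(real^'n) set \<Rightarrow> (real^'n \<Rightarrow> real^'n \<Rightarrow> real) \<Rightarrow> bool" where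
  "finsler_metric_on U F \<longleftrightarrow>
     (\<forall>x\<in>U. \<forall>y. 0 \<le> F x y) \<and>
     smooth_on (U \<times> (- {0})) (\<lambda>(x, y). F x y) \<and>
     (\<forall>x\<in>U. \<forall>y. \<forall>t>0. F x (t *\<^sub>R y) = t * F x y) \<and>
     (\<forall>x\<in>U. \<forall>y. y \<noteq> 0 \<longrightarrow>
        (\<forall>v. v \<noteq> 0 \<longrightarrow> 0 < v \<bullet> (fundamental_tensor F x y *v v)))"

definition spray :: "(real^'n \<Rightarrow> real^'n \<Rightarrow> real) \<Rightarrow> real^'n \<Rightarrow> real^'n \<Rightarrow> real^'n" where
  "spray F x y = (\<chi> i. 1/4 * (\<Sum>l\<in>UNIV. matrix_inv (fundamental_tensor F x y) $ i $ l *
     (\<Sum>j\<in>UNIV. \<Sum>k\<in>UNIV.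
        (pd k (\<lambda>z. fundamental_tensor F z y $ j $ l) x
         + pd j (\<lambda>z. fundamental_tensor F z y $ l $ k) x
         - pd l (\<lambda>z. fundamental_tensor F z y $ j $ k) x) * y $ j * y $ k)))"

text \<open>Nonconstant solutions of $\ddot c + 2 G(c, \dot c) = 0$ in \<open>U\<close> over an open interval;
  this is the geodesic equation for the normalisation of the spray coefficients above.\<close>

definition geodesic_on ::
    "(real^'n) set \<Rightarrow> (real^'n \<Rightarrow> real^'n \<Rightarrow> real) \<Rightarrow> real set \<Rightarrow> (real \<Rightarrow> real^'n) \<Rightarrow> bool" where
  "geodesic_on U F I c \<longleftrightarrow> open I \<and> is_interval I \<and>
     (\<exists>c'. \<forall>t\<in>I. c t \<in> U \<and> c' t \<noteq> 0 \<and>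
        (c has_vector_derivative c' t) (at t) \<and>
        (c' has_vector_derivative - 2 *\<^sub>R spray F (c t) (c' t)) (at t))"

text \<open>Straightness is a condition on the point set traced out by the geodesic, not on its
  parametrization.\<close>

definition projectively_flat_on :: "(real^'n) set \<Rightarrow> (real^'n \<Rightarrow> real^'n \<Rightarrow> real) \<Rightarrow> bool" where
  "projectively_flat_on U F \<longleftrightarrow> (\<forall>I c. geodesic_on U F I c \<longrightarrow> collinear (c ` I))"

section \<open>Riemannian metrics and 1-forms\<close>

definition riemannian_metric_on :: "(real^'n) set \<Rightarrow> (real^'n \<Rightarrow> real^'n^'n) \<Rightarrow> bool" where
  "riemannian_metric_on U a \<longleftrightarrow> smooth_on U a \<and>
     (\<forall>x\<in>U. transpose (a x) = a x \<and> (\<forall>v. v \<noteq> 0 \<longrightarrow> 0 < v \<bullet> (a x *v v)))"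

definition riem_norm :: "(real^'n \<Rightarrow> real^'n^'n) \<Rightarrow> real^'n \<Rightarrow> real^'n \<Rightarrow> real" where
  "riem_norm a x y = sqrt (y \<bullet> (a x *v y))"

definition raise :: "(real^'n \<Rightarrow> real^'n^'n) \<Rightarrow> real^'n \<Rightarrow> real^'n \<Rightarrow> real^'n" where
  "raise a x w = matrix_inv (a x) *v w"

definition christoffel ::
    "(real^'n \<Rightarrow> real^'n^'n) \<Rightarrow> real^'n \<Rightarrow> 'n \<Rightarrow> 'n \<Rightarrow> 'n \<Rightarrow> real" where
  "christoffel a x k i j = 1/2 * (\<Sum>l\<in>UNIV. matrix_inv (a x) $ k $ l *
     (pd i (\<lambda>z. a z $ j $ l) x + pd j (\<lambda>z. a z $ i $ l) x - pd l (\<lambda>z. a z $ i $ j) x))"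

text \<open>Entry \<open>(i, j)\<close> is $b_{i|j}$: the second index is the direction of differentiation.\<close>

definition cov_deriv ::
    "(real^'n \<Rightarrow> real^'n^'n) \<Rightarrow> (real^'n \<Rightarrow> real^'n) \<Rightarrow> real^'n \<Rightarrow> real^'n^'n" where
  "cov_deriv a b x =
     (\<chi> i j. pd j (\<lambda>z. b z $ i) x - (\<Sum>k\<in>UNIV. christoffel a x k i j * b x $ k))"

definition r_tensor ::
    "(real^'n \<Rightarrow> real^'n^'n) \<Rightarrow> (real^'n \<Rightarrow> real^'n) \<Rightarrow> real^'n \<Rightarrow> real^'n^'n" where
  "r_tensor a b x = (\<chi> i j. 1/2 * (cov_deriv a b x $ i $ j + cov_deriv a b x $ j $ i))"

definition s_tensor ::
    "(real^'n \<Rightarrow> real^'n^'n) \<Rightarrow> (real^'n \<Rightarrow> real^'n) \<Rightarrow> real^'n \<Rightarrow> real^'n^'n" where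
  "s_tensor a b x = (\<chi> i j. 1/2 * (cov_deriv a b x $ i $ j - cov_deriv a b x $ j $ i))"

definition r_00 ::
    "(real^'n \<Rightarrow> real^'n^'n) \<Rightarrow> (real^'n \<Rightarrow> real^'n) \<Rightarrow> real^'n \<Rightarrow> real^'n \<Rightarrow> real" where
  "r_00 a b x y = (\<Sum>i\<in>UNIV. \<Sum>j\<in>UNIV. r_tensor a b x $ i $ j * y $ i * y $ j)"

definition s_low0 ::
    "(real^'n \<Rightarrow> real^'n^'n) \<Rightarrow> (real^'n \<Rightarrow> real^'n) \<Rightarrow> real^'n \<Rightarrow> real^'n \<Rightarrow> real^'n" where
  "s_low0 a b x y = s_tensor a b x *v y"

definition s_up0 ::
    "(real^'n \<Rightarrow> real^'n^'n) \<Rightarrow> (real^'n \<Rightarrow> real^'n) \<Rightarrow> real^'n \<Rightarrow> real^'n \<Rightarrow> real^'n" where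
  "s_up0 a b x y = raise a x (s_low0 a b x y)"

section \<open>$(\alpha,\beta,\gamma)$-metrics\<close>

text \<open>The coefficients $b_i$ and $\gamma_i$ of the two 1-forms are \<open>b\<close> and \<open>c\<close>; the two
  arguments $s$, $\bar s$ of $\Psi$ form a pair.\<close>

definition d1 :: "(real \<times> real \<Rightarrow> real) \<Rightarrow> real \<times> real \<Rightarrow> real" where
  "d1 f p = frechet_derivative f (at p) (1, 0)"

definition d2 :: "(real \<times> real \<Rightarrow> real) \<Rightarrow> real \<times> real \<Rightarrow> real" where
  "d2 f p = frechet_derivative f (at p) (0, 1)"

context
  fixes a :: "real^'n \<Rightarrow> real^'n^'n"
    and b c :: "real^'n \<Rightarrow> real^'n"
    and \<Psi> :: "real \<times> real \<Rightarrow> real"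
    and x y :: "real^'n"
begin

definition "s_val = (b x \<bullet> y) / riem_norm a x y"
definition "sbar_val = (c x \<bullet> y) / riem_norm a x y"
definition "s_pair = (s_val, sbar_val)"

definition abg_fun :: real where
  "abg_fun = riem_norm a x y * \<Psi> s_pair"

definition "bsq = b x \<bullet> raise a x (b x)"
definition "gsq = c x \<bullet> raise a x (c x)"
definition "theta = b x \<bullet> raise a x (c x)"

definition alpha_low :: "real^'n" where
  "alpha_low = (\<chi> i. pd i (riem_norm a x) y)"
definition "h_low = b x - s_val *\<^sub>R alpha_low"
definition "hbar_low = c x - sbar_val *\<^sub>R alpha_low"
definition alpha_h :: "real^'n^'n" where
  "alpha_h = (\<chi> i j. a x $ i $ j - alpha_low $ i * alpha_low $ j)"

definition "Pi_val = \<Psi> s_pair - s_val * d1 \<Psi> s_pair - sbar_val * d2 \<Psi> s_pair"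

definition "J_val =
  (d1 (d1 \<Psi>) s_pair * d2 (d2 \<Psi>) s_pair - (d2 (d1 \<Psi>) s_pair)\<^sup>2) / Pi_val"

definition "Gam_val = Pi_val
  + (bsq - s_val\<^sup>2) * d1 (d1 \<Psi>) s_pair
  + (gsq - sbar_val\<^sup>2) * d2 (d2 \<Psi>) s_pair
  + 2 * (theta - s_val * sbar_val) * d2 (d1 \<Psi>) s_pair
  + ((bsq - s_val\<^sup>2) * (gsq - sbar_val\<^sup>2) - (theta - s_val * sbar_val)\<^sup>2) * J_val"

definition "beta_s0 = raise a x (b x) \<bullet> s_low0 a b x y"
definition "beta_sbar0 = c x \<bullet> s_up0 a b x y"
definition "gamma_s0 = raise a x (c x) \<bullet> s_low0 a c x y"
definition "gamma_sbar0 = b x \<bullet> s_up0 a c x y"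

definition "R_beta = r_00 a b x y
  - 2 * riem_norm a x y / Pi_val * (d1 \<Psi> s_pair * beta_s0 + d2 \<Psi> s_pair * gamma_sbar0)"
definition "R_gamma = r_00 a c x y
  - 2 * riem_norm a x y / Pi_val * (d1 \<Psi> s_pair * beta_sbar0 + d2 \<Psi> s_pair * gamma_s0)"

definition "Gam1 =
  (d1 (d1 \<Psi>) s_pair + (gsq - sbar_val\<^sup>2) * J_val) * R_beta
  + (d2 (d1 \<Psi>) s_pair - (theta - s_val * sbar_val) * J_val) * R_gamma"
definition "Gam2 =
  (d2 (d2 \<Psi>) s_pair + (bsq - s_val\<^sup>2) * J_val) * R_gamma
  + (d2 (d1 \<Psi>) s_pair - (theta - s_val * sbar_val) * J_val) * R_beta"

end

definition abg_metric_on ::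
    "(real^'n) set \<Rightarrow> (real^'n \<Rightarrow> real^'n^'n) \<Rightarrow> (real^'n \<Rightarrow> real^'n) \<Rightarrow> (real^'n \<Rightarrow> real^'n)
     \<Rightarrow> real \<Rightarrow> real \<Rightarrow> (real \<times> real \<Rightarrow> real) \<Rightarrow> bool" where
  "abg_metric_on U a b c b0 g0 \<Psi> \<longleftrightarrow>
     riemannian_metric_on U a \<and> smooth_on U b \<and> smooth_on U c \<and>
     (\<forall>x\<in>U. sqrt (bsq a b x) < b0 \<and> sqrt (gsq a c x) < g0) \<and>
     smooth_on ({- b0<..<b0} \<times> {- g0<..<g0}) \<Psi> \<and>
     (\<forall>p \<in> {- b0<..<b0} \<times> {- g0<..<g0}. 0 < \<Psi> p) \<and>
     finsler_metric_on U (abg_fun a b c \<Psi>)"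

end

theory Submission
  imports Defs
begin

text \<open>Write $E_l = F_{x^k y^l} y^k - F_{x^l}$ for the Euler--Lagrange expression of $F$. Homogeneity
  gives $4 g_{il} G^i = 2 F E_l + 2 F_{x^k} y^k F_{y^l}$, and $E_l y^l = 0$, so that $G$ is parallel to
  $y$ exactly if $E = 0$ (Hamel). A geodesic satisfies $c'' = -2 G(c, c')$: if $G$ is parallel to the
  velocity then the unit tangent is constant and the geodesic is straight; conversely
  Picard's theorem provides a geodesic through every $(x, y)$, and straightness forces $c''$ to be
  parallel to $c'$. For $F = \alpha \Psi(s, \bar s)$ the expression $E_j$ equals $2\Pi/\alpha$ times
  ${}^{\alpha}h_{ij}\,{}^{\alpha}G^i + (\alpha/\Pi)(\Psi_s\,{}^{\beta}s_{j0} + \Psi_{\bar s}\,{}^{\gamma}s_{j0})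
  + (A h_j + B \bar h_j)/(2\Pi)$, where $A$, $B$ are linear in
  $X = {}^{\beta}r_{00} + 2 h_i\,{}^{\alpha}G^i$ and $Y = {}^{\gamma}r_{00} + 2 \bar h_i\,{}^{\alpha}G^i$.
  Contracting the equation with $b^j$ and $\gamma^j$ gives a $2 \times 2$ linear system for
  $X$, $Y$ with determinant $\Pi\Gamma$, whose solution turns $A/\Pi$, $B/\Pi$ into $\Gamma_1/\Gamma$,
  $\Gamma_2/\Gamma$.\<close>

section \<open>Calculus of smooth functions\<close>

lemma k_smooth_on_cong:
  assumes "open S" "\<And>x. x \<in> S \<Longrightarrow> f x = g x" "k_smooth_on k S f"
  shows "k_smooth_on k S g"
  using assms(2,3)
proof (induction k arbitrary: f g)
  case 0
  then show ?case by (auto cong: continuous_on_cong)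
next
  case (Suc k)
  have fg: "(g has_derivative frechet_derivative f (at x)) (at x)" if "x \<in> S" for x
  proof (rule has_derivative_transform_within_open[OF _ \<open>open S\<close> that])
    show "(f has_derivative frechet_derivative f (at x)) (at x)"
      using Suc.prems that by (simp add: frechet_derivative_works)
  qed (use Suc.prems in auto)
  then have eq: "frechet_derivative g (at x) = frechet_derivative f (at x)" if "x \<in> S" for x
    using that frechet_derivative_at by metis
  show ?case
    using Suc.prems fg Suc.IH[of "\<lambda>x. frechet_derivative f (at x) v" "\<lambda>x. frechet_derivative g (at x) v" for v]
    by (auto simp: eq differentiable_def)
qed

lemma k_smooth_on_SucD: "k_smooth_on (Suc k) S f \<Longrightarrow> k_smooth_on k S f"
proof (induction k arbitrary: f)
  case 0
  then show ?case
    by (auto intro!: continuous_at_imp_continuous_on differentiable_imp_continuous_within)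
next
  case (Suc k)
  then show ?case by (metis k_smooth_on.simps(2))
qed

text \<open>Derivatives are unique, so any known derivative \<open>f'\<close> may stand in for the
  chosen \<open>frechet_derivative\<close>. Each closure property below is this rule combined with
  one differentiation rule and induction on the order.\<close>

lemma k_smooth_on_SucI:
  assumes "open S" "\<And>x. x \<in> S \<Longrightarrow> (f has_derivative f' x) (at x)"
    and "\<And>v. k_smooth_on k S (\<lambda>x. f' x v)"
  shows "k_smooth_on (Suc k) S f"
proof -
  have "frechet_derivative f (at x) = f' x" if "x \<in> S" for x
    using assms(2)[OF that] frechet_derivative_at by metis
  then have "k_smooth_on k S (\<lambda>x. frechet_derivative f (at x) v)" for v
    by (intro k_smooth_on_cong[OF assms(1) _ assms(3)]) auto
  then show ?thesis using assms(2) by (auto simp: differentiable_def)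
qed

lemma k_smooth_on_const: "open S \<Longrightarrow> k_smooth_on k S (\<lambda>x. c)"
  by (induction k arbitrary: c) auto

lemma k_smooth_on_bounded_linear:
  assumes "open S" "bounded_linear f"
  shows "k_smooth_on k S f"
proof (cases k)
  case 0
  then show ?thesis using assms by (simp add: linear_continuous_on)
next
  case (Suc m)
  then show ?thesis
    using assms by (auto simp del: k_smooth_on.simps intro!: k_smooth_on_SucI[where f'="\<lambda>_. f"] bounded_linear_imp_has_derivative
        k_smooth_on_const)
qed

lemma k_smooth_on_has_derivative:
  "k_smooth_on (Suc k) S f \<Longrightarrow> x \<in> S \<Longrightarrow> (f has_derivative frechet_derivative f (at x)) (at x)"
  by (simp add: frechet_derivative_works)

lemma k_smooth_on_add:
  assumes "open S"
  shows "k_smooth_on k S f \<Longrightarrow> k_smooth_on k S g \<Longrightarrow> k_smooth_on k S (\<lambda>x. f x + g x)"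
proof (induction k arbitrary: f g)
  case 0
  then show ?case by (auto intro: continuous_intros)
next
  case (Suc k)
  show ?case
    by (rule k_smooth_on_SucI[OF assms has_derivative_add[OF
          Suc.prems(1)[THEN k_smooth_on_has_derivative] Suc.prems(2)[THEN k_smooth_on_has_derivative]]])
      (use Suc in auto)
qed

lemma k_smooth_on_mult:
  fixes f g :: "'a::real_normed_vector \<Rightarrow> real"
  assumes "open S"
  shows "k_smooth_on k S f \<Longrightarrow> k_smooth_on k S g \<Longrightarrow> k_smooth_on k S (\<lambda>x. f x * g x)"
proof (induction k arbitrary: f g)
  case 0
  then show ?case by (auto intro: continuous_intros)
next
  case (Suc k)
  \<comment> \<open>The product rule leaves one factor undifferentiated in each term, so the factors
    themselves are needed at order \<open>k\<close>.\<close>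
  note lower = Suc.prems(1)[THEN k_smooth_on_SucD] Suc.prems(2)[THEN k_smooth_on_SucD]
  show ?case
    by (rule k_smooth_on_SucI[OF assms has_derivative_mult[OF
          Suc.prems(1)[THEN k_smooth_on_has_derivative] Suc.prems(2)[THEN k_smooth_on_has_derivative]]])
      (use Suc lower in \<open>auto intro!: k_smooth_on_add assms\<close>)
qed

text \<open>The derivative of the reciprocal contains the reciprocal again, but only to order
  \<open>k\<close>, where the induction hypothesis supplies it. Hence \<open>f\<close> stays fixed
  in the induction, unlike in the sum and product rules.\<close>

lemma k_smooth_on_inverse:
  fixes f :: "'a::real_normed_vector \<Rightarrow> real"
  assumes "open S" and nz: "\<And>x. x \<in> S \<Longrightarrow> f x \<noteq> 0"
  shows "k_smooth_on k S f \<Longrightarrow> k_smooth_on k S (\<lambda>x. inverse (f x))"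
proof (induction k)
  case 0
  then show ?case using nz by (auto intro: continuous_intros)
next
  case (Suc k)
  have inv: "k_smooth_on k S (\<lambda>x. inverse (f x))"
    using Suc k_smooth_on_SucD by blast
  have "k_smooth_on k S (\<lambda>x. - 1 * (inverse (f x) * frechet_derivative f (at x) v * inverse (f x)))" for v
    using Suc.prems by (intro k_smooth_on_mult k_smooth_on_const inv assms) auto
  then show ?case
    by (intro k_smooth_on_SucI[OF assms(1) Deriv.has_derivative_inverse[OF nz
          Suc.prems[THEN k_smooth_on_has_derivative]]]) simp_all
qed

lemma k_smooth_on_sum:
  assumes "open S" "\<And>i. i \<in> I \<Longrightarrow> k_smooth_on k S (f i)"
  shows "k_smooth_on k S (\<lambda>x. \<Sum>i\<in>I. f i x)"
  using assms(2)
  by (induction I rule: infinite_finite_induct)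
    (auto intro!: k_smooth_on_const k_smooth_on_add assms(1))

lemma k_smooth_on_prod:
  fixes f :: "'i \<Rightarrow> 'a::real_normed_vector \<Rightarrow> real"
  assumes "open S" "\<And>i. i \<in> I \<Longrightarrow> k_smooth_on k S (f i)"
  shows "k_smooth_on k S (\<lambda>x. \<Prod>i\<in>I. f i x)"
  using assms(2)
  by (induction I rule: infinite_finite_induct)
    (auto intro!: k_smooth_on_const k_smooth_on_mult assms(1))

text \<open>The Leibniz formula is a polynomial in the entries. Together with Cramer's rule this
  handles the inverse of the fundamental tensor.\<close>

lemma k_smooth_on_det:
  fixes M :: "'a::real_normed_vector \<Rightarrow> real^'n^'n"
  assumes "open S" "\<And>i j. k_smooth_on k S (\<lambda>x. M x $ i $ j)"
  shows "k_smooth_on k S (\<lambda>x. det (M x))"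
  unfolding det_def
  by (intro k_smooth_on_sum k_smooth_on_mult k_smooth_on_prod k_smooth_on_const assms)

lemma smooth_on_has_derivative:
  "smooth_on S f \<Longrightarrow> x \<in> S \<Longrightarrow> (f has_derivative frechet_derivative f (at x)) (at x)"
  unfolding smooth_on_def using k_smooth_on_has_derivative by blast

lemma smooth_on_frechet_derivative:
  "smooth_on S f \<Longrightarrow> smooth_on S (\<lambda>x. frechet_derivative f (at x) v)"
  unfolding smooth_on_def using k_smooth_on.simps(2) by blast

lemma smooth_on_mult:
  fixes f g :: "'a::real_normed_vector \<Rightarrow> real"
  shows "open S \<Longrightarrow> smooth_on S f \<Longrightarrow> smooth_on S g \<Longrightarrow> smooth_on S (\<lambda>x. f x * g x)"
  unfolding smooth_on_def using k_smooth_on_mult by blast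

lemma smooth_on_continuous_on: "smooth_on S f \<Longrightarrow> continuous_on S f"
  unfolding smooth_on_def using k_smooth_on.simps(1) by blast

section \<open>Symmetry of mixed second derivatives\<close>

lemma parallelogram_in_ball:
  fixes x u v :: "'a::real_normed_vector"
  assumes "0 \<le> s" "s \<le> h" "0 \<le> t" "t \<le> h" "h * (norm u + norm v) < r"
  shows "x + s *\<^sub>R u + t *\<^sub>R v \<in> ball x r"
proof -
  have "norm (s *\<^sub>R u + t *\<^sub>R v) \<le> s * norm u + t * norm v"
    using assms norm_triangle_ineq[of "s *\<^sub>R u" "t *\<^sub>R v"] by simp
  also have "\<dots> \<le> h * norm u + h * norm v"
    using assms by (intro add_mono mult_right_mono) auto
  also have "\<dots> < r" using assms(5) by (simp add: distrib_left)
  finally have "x + (s *\<^sub>R u + t *\<^sub>R v) \<in> ball x r" 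
    using dist_add_cancel[of x 0] by simp
  then show ?thesis by (simp add: add.assoc)
qed

text \<open>Two one-dimensional mean value theorems: one in the direction \<open>u\<close>, applied
  to the increment \<open>\<phi>\<close> in the direction \<open>v\<close>, and one in the direction
  \<open>v\<close>, applied to the derivative along \<open>u\<close>. The left side of the
  conclusion is symmetric in \<open>u\<close> and \<open>v\<close>, the right side is a mixed
  derivative in a fixed order.\<close>

lemma second_difference_mean_value:
  fixes f :: "'a::real_normed_vector \<Rightarrow> real"
  assumes df: "\<And>p. p \<in> ball x r \<Longrightarrow> (f has_derivative f' p) (at p)"
    and ddf: "\<And>p. p \<in> ball x r \<Longrightarrow> ((\<lambda>q. f' q u) has_derivative f'' p) (at p)"
    and h: "0 < h" "h * (norm u + norm v) < r"
  obtains s t where "0 < s" "s < h" "0 < t" "t < h"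
    "f (x + h *\<^sub>R u + h *\<^sub>R v) - f (x + h *\<^sub>R u) - f (x + h *\<^sub>R v) + f x
      = h * h * f'' (x + s *\<^sub>R u + t *\<^sub>R v) v"
proof -
  note inb = parallelogram_in_ball[OF _ _ _ _ h(2)]
  define \<phi> where "\<phi> s = f (x + s *\<^sub>R u + h *\<^sub>R v) - f (x + s *\<^sub>R u)" for s
  have d\<phi>: "(\<phi> has_real_derivative (f' (x + s *\<^sub>R u + h *\<^sub>R v) u - f' (x + s *\<^sub>R u) u)) (at s)"
    if "0 \<le> s" "s \<le> h" for s
  proof -
    have 1: "((\<lambda>s. f (x + s *\<^sub>R u + t *\<^sub>R v)) has_derivative (\<lambda>k. f' (x + s *\<^sub>R u + t *\<^sub>R v) (k *\<^sub>R u))) (at s)"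
      if "0 \<le> t" "t \<le> h" for t
      by (rule has_derivative_compose[of "\<lambda>s. x + s *\<^sub>R u + t *\<^sub>R v", OF _ df[OF inb]])
        (auto intro!: derivative_eq_intros simp: that \<open>0 \<le> s\<close> \<open>s \<le> h\<close>)
    have lin: "f' p (k *\<^sub>R u) = k * f' p u" if "p \<in> ball x r" for p k
      using linear_scale[OF has_derivative_linear[OF df[OF that]]] by simp
    have 2: "((\<lambda>s. f (x + s *\<^sub>R u + t *\<^sub>R v)) has_real_derivative f' (x + s *\<^sub>R u + t *\<^sub>R v) u) (at s)"
      if "0 \<le> t" "t \<le> h" for t
      using 1[OF that] inb[OF \<open>0 \<le> s\<close> \<open>s \<le> h\<close> that]
      by (simp add: has_field_derivative_def lin mult.commute[of _ "f' _ _"])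
    show ?thesis
      unfolding \<phi>_def using DERIV_diff[OF 2[of h] 2[of 0]] h by simp
  qed
  obtain s where s: "0 < s" "s < h" "\<phi> h - \<phi> 0 = h * (f' (x + s *\<^sub>R u + h *\<^sub>R v) u - f' (x + s *\<^sub>R u) u)"
    using MVT2[OF h(1), of \<phi> "\<lambda>s. f' (x + s *\<^sub>R u + h *\<^sub>R v) u - f' (x + s *\<^sub>R u) u"] d\<phi> by auto
  have d2: "((\<lambda>t. f' (x + s *\<^sub>R u + t *\<^sub>R v) u) has_real_derivative f'' (x + s *\<^sub>R u + t *\<^sub>R v) v) (at t)"
    if "0 \<le> t" "t \<le> h" for t
  proof -
    have b: "x + s *\<^sub>R u + t *\<^sub>R v \<in> ball x r" using inb that s by auto
    have "((\<lambda>t. f' (x + s *\<^sub>R u + t *\<^sub>R v) u) has_derivative (\<lambda>k. f'' (x + s *\<^sub>R u + t *\<^sub>R v) (k *\<^sub>R v))) (at t)"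
      by (rule has_derivative_compose[of "\<lambda>t. x + s *\<^sub>R u + t *\<^sub>R v", OF _ ddf[OF b]])
        (auto intro!: derivative_eq_intros)
    then show ?thesis
      using linear_scale[OF has_derivative_linear[OF ddf[OF b]]]
      by (simp add: has_field_derivative_def mult.commute[of _ "f'' _ _"])
  qed
  obtain t where t: "0 < t" "t < h"
    "f' (x + s *\<^sub>R u + h *\<^sub>R v) u - f' (x + s *\<^sub>R u) u = h * f'' (x + s *\<^sub>R u + t *\<^sub>R v) v"
    using MVT2[OF h(1), of "\<lambda>t. f' (x + s *\<^sub>R u + t *\<^sub>R v) u" "\<lambda>t. f'' (x + s *\<^sub>R u + t *\<^sub>R v) v"] d2 by auto
  show ?thesis
    by (rule that[OF s(1,2) t(1,2)]) (use s(3) t(3) in \<open>simp add: \<phi>_def\<close>)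
qed

text \<open>The same second difference equals \<open>h * h\<close> times either mixed derivative,
  each taken at some point near \<open>x\<close>. Were the two mixed derivatives different at
  \<open>x\<close>, continuity would keep their values apart on a whole ball.\<close>

lemma frechet_derivative_commute:
  fixes f :: "'a::real_normed_vector \<Rightarrow> real"
  assumes S: "open S" "x \<in> S" and f: "smooth_on S f"
  shows "frechet_derivative (\<lambda>p. frechet_derivative f (at p) u) (at x) v
    = frechet_derivative (\<lambda>p. frechet_derivative f (at p) v) (at x) u"
proof (rule ccontr)
  define D where "D u v p = frechet_derivative (\<lambda>p. frechet_derivative f (at p) u) (at p) v" for u v p
  assume "\<not> ?thesis"
  \<comment> \<open>Half the gap: two numbers strictly within \<open>?e\<close> of the respective
    values at \<open>x\<close> cannot coincide.\<close>
  then have pos: "0 < \<bar>D u v x - D v u x\<bar> / 2" (is "0 < ?e") by (auto simp: D_def)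
  have "smooth_on S (D u v)" for u v
    unfolding D_def by (intro smooth_on_frechet_derivative f)
  then have "isCont (D u v) x" for u v
    using S smooth_on_continuous_on continuous_on_eq_continuous_at by blast
  then have "\<forall>\<^sub>F p in nhds x. dist (D u v p) (D u v x) < ?e" for u v
    using pos by (intro tendstoD) (simp_all add: isCont_def tendsto_at_iff_tendsto_nhds[symmetric])
  then have "\<forall>\<^sub>F p in nhds x. p \<in> S \<and> dist (D u v p) (D u v x) < ?e \<and> dist (D v u p) (D v u x) < ?e"
    using S by (intro eventually_conj eventually_nhds_in_open) auto
  then obtain r where r: "0 < r"
    "\<And>p. p \<in> ball x r \<Longrightarrow> p \<in> S \<and> dist (D u v p) (D u v x) < ?e \<and> dist (D v u p) (D v u x) < ?e"
    by (force simp: eventually_nhds_metric dist_commute)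
  \<comment> \<open>The summand 1 keeps the denominator positive when \<open>u\<close> and
    \<open>v\<close> vanish; the parallelogram of side factor \<open>h\<close> then lies in the ball
    of radius \<open>r\<close>.\<close>
  define h where "h = r / (2 * (norm u + norm v + 1))"
  have n0: "0 < norm u + norm v + 1" by (smt (verit) norm_ge_zero)
  have h: "0 < h" using r n0 by (simp add: h_def)
  have "h * (norm u + norm v + 1) = r / 2" using n0 unfolding h_def by (metis nonzero_mult_divide_mult_cancel_right less_irrefl times_divide_eq_left)
  then have hr: "h * (norm u + norm v) < r" using h r(1) by (simp add: algebra_simps)
  have *: "\<exists>p\<in>ball x r. f (x + h *\<^sub>R u + h *\<^sub>R v) - f (x + h *\<^sub>R u) - f (x + h *\<^sub>R v) + f x = h * h * D u v p"
    if hr: "h * (norm u + norm v) < r" for u v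
  proof -
    have d: "(f has_derivative frechet_derivative f (at p)) (at p)"
      "((\<lambda>q. frechet_derivative f (at q) u) has_derivative
         frechet_derivative (\<lambda>q. frechet_derivative f (at q) u) (at p)) (at p)" if "p \<in> ball x r" for p
      using r(2)[OF that] smooth_on_has_derivative f smooth_on_frechet_derivative by blast+
    obtain s t where st: "0 < s" "s < h" "0 < t" "t < h"
      "f (x + h *\<^sub>R u + h *\<^sub>R v) - f (x + h *\<^sub>R u) - f (x + h *\<^sub>R v) + f x
        = h * h * D u v (x + s *\<^sub>R u + t *\<^sub>R v)"
      by (rule second_difference_mean_value[OF d h hr]) (auto simp: D_def)
    have "x + s *\<^sub>R u + t *\<^sub>R v \<in> ball x r"
      using parallelogram_in_ball[OF _ _ _ _ hr] st by auto
    then show ?thesis using st(5) by auto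
  qed
  obtain p where p: "p \<in> ball x r"
    "f (x + h *\<^sub>R u + h *\<^sub>R v) - f (x + h *\<^sub>R u) - f (x + h *\<^sub>R v) + f x = h * h * D u v p"
    using *[OF hr] by auto
  obtain q where q: "q \<in> ball x r"
    "f (x + h *\<^sub>R v + h *\<^sub>R u) - f (x + h *\<^sub>R v) - f (x + h *\<^sub>R u) + f x = h * h * D v u q"
    using *[of v u] hr by (auto simp: add.commute)
  have "x + h *\<^sub>R v + h *\<^sub>R u = x + h *\<^sub>R u + h *\<^sub>R v" by simp
  then have "h * h * D u v p = h * h * D v u q" using p(2) q(2) by (smt (verit, best))
  then have "D u v p = D v u q" using h by simp
  then show False
    using r(2)[OF p(1)] r(2)[OF q(1)] by (auto simp: dist_real_def abs_if split: if_splits)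
qed

section \<open>Ordinary differential equations and straight curves\<close>

text \<open>The mean value inequality in one variable. Applied to a single integral it keeps the
  Picard iterates in the ball; applied to the difference of two integrals it yields the contraction
  estimate.\<close>

lemma has_vector_derivative_bound:
  fixes f :: "real \<Rightarrow> 'a::real_normed_vector"
  assumes "\<And>t. t \<in> {a..b} \<Longrightarrow> (f has_vector_derivative f' t) (at t within {a..b})"
    and "\<And>t. t \<in> {a..b} \<Longrightarrow> norm (f' t) \<le> B" and "s \<in> {a..b}" "t \<in> {a..b}"
  shows "norm (f t - f s) \<le> B * \<bar>t - s\<bar>"
proof -
  have "onorm (\<lambda>h. h *\<^sub>R f' t) \<le> B" if "t \<in> {a..b}" for t
  proof (rule onorm_bound)
    show "0 \<le> B" using assms(2)[OF that] norm_ge_zero order_trans by blast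
    show "norm (h *\<^sub>R f' t) \<le> B * norm h" for h
      using mult_left_mono[OF assms(2)[OF that], of "\<bar>h\<bar>"] by (simp add: mult.commute)
  qed
  then show ?thesis
    using differentiable_bound[OF convex_real_interval(5), of a b f "\<lambda>t h. h *\<^sub>R f' t" B t s] assms
    by (simp add: has_vector_derivative_def)
qed

text \<open>Banach's fixed point theorem for the integral operator \<open>T\<close> on the bounded
  continuous functions with values in the closed ball, a closed subset of a complete space.\<close>

lemma picard_local_existence:
  fixes H :: "'a::banach \<Rightarrow> 'a"
  assumes "0 < r" and lip: "L-lipschitz_on (cball x0 r) H"
  obtains e X where "0 < e" "X 0 = x0"
    "\<forall>t\<in>{-e<..<e}. X t \<in> cball x0 r \<and> (X has_vector_derivative H (X t)) (at t)"
proof -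
  have L: "0 \<le> L" using lip lipschitz_on_nonneg by blast
  define M where "M = norm (H x0) + L * r"
  have HM: "norm (H z) \<le> M" if "z \<in> cball x0 r" for z
  proof -
    have "dist (H z) (H x0) \<le> L * dist z x0"
      using lipschitz_onD[OF lip that, of x0] \<open>0 < r\<close> by simp
    also have "\<dots> \<le> L * r" using that L by (intro mult_left_mono) (auto simp: dist_commute)
    finally show ?thesis
      using norm_triangle_sub[of "H z" "H x0"] by (simp add: M_def dist_norm)
  qed
  have M: "0 \<le> M" using L \<open>0 < r\<close> by (simp add: M_def)
  \<comment> \<open>The first bound gives \<open>M * e \<le> r\<close>, so that \<open>T\<close>
    maps the ball-valued functions to themselves; the second gives \<open>L * e \<le> 1 / 2\<close>,
    the contraction factor. The summands 1 avoid division by zero.\<close>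
  define e where "e = min (r / (M + 1)) (1 / (2 * (L + 1)))"
  have e: "0 < e" using M L \<open>0 < r\<close> by (simp add: e_def)
  have "e * (M + 1) \<le> r / (M + 1) * (M + 1)" using M by (intro mult_right_mono) (auto simp: e_def)
  then have "e * (M + 1) \<le> r" using M by simp
  then have eM: "M * e \<le> r" using e by (simp add: algebra_simps)
  have "e * (2 * (L + 1)) \<le> 1 / (2 * (L + 1)) * (2 * (L + 1))"
    using L by (intro mult_right_mono) (auto simp: e_def)
  then have "e * (2 * (L + 1)) \<le> 1" using L by simp
  then have eL: "L * e \<le> 1 / 2" using e by (simp add: algebra_simps)
  \<comment> \<open>Members of the function space live on the whole real line, the integral equation
    on [-e, e]. Clamping the time extends the integral by constants, which keeps it bounded and
    continuous.\<close>
  define \<tau> where "\<tau> t = max (- e) (min e t)" for t :: real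
  have \<tau>: "\<tau> t \<in> {-e..e}" "\<bar>\<tau> t\<bar> \<le> e" for t using e by (auto simp: \<tau>_def)
  define K :: "(real \<Rightarrow>\<^sub>C 'a) set" where "K = PiC UNIV (\<lambda>_. cball x0 r)"
  \<comment> \<open>Starting at the left end point gives one differentiation rule for both signs of
    \<open>t\<close>; the subtraction of \<open>J f 0\<close> in \<open>T\<close> restores the
    initial value at time 0.\<close>
  define J where "J f t = integral {-e..t} (\<lambda>s. H (apply_bcontfun f s))" for f t
  have KD: "apply_bcontfun f t \<in> cball x0 r" if "f \<in> K" for f t
    using that by (auto simp: K_def mem_PiC_iff Pi_iff simp del: mem_cball)
  have dJ: "(J f has_vector_derivative H (apply_bcontfun f t)) (at t within {-e..e})"
    if "f \<in> K" "t \<in> {-e..e}" for f t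
  proof -
    have "continuous_on {-e..e} (\<lambda>s. H (apply_bcontfun f s))"
      by (rule continuous_on_compose2[OF lipschitz_on_continuous_on[OF lip]])
        (use KD[OF that(1)] in \<open>auto simp del: mem_cball\<close>)
    then show ?thesis unfolding J_def using that by (intro integral_has_vector_derivative) auto
  qed
  have boundJ: "norm (J f t - J f 0) \<le> M * \<bar>t\<bar>" if "f \<in> K" "t \<in> {-e..e}" for f t
    using has_vector_derivative_bound[OF dJ[OF that(1)] HM[OF KD[OF that(1)]], of 0 t] that e by simp
  have lipJ: "norm ((J f t - J g t) - (J f 0 - J g 0)) \<le> L * dist f g * \<bar>t\<bar>"
    if "f \<in> K" "g \<in> K" "t \<in> {-e..e}" for f g t
  proof -
    have "norm (H (apply_bcontfun f s) - H (apply_bcontfun g s)) \<le> L * dist f g" for s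
    proof -
      have "norm (H (apply_bcontfun f s) - H (apply_bcontfun g s)) \<le> L * dist (apply_bcontfun f s) (apply_bcontfun g s)"
        using lipschitz_onD[OF lip KD[OF that(1)] KD[OF that(2)]] by (simp add: dist_norm)
      also have "\<dots> \<le> L * dist f g" using L dist_bounded by (intro mult_left_mono) auto
      finally show ?thesis .
    qed
    then show ?thesis
      using has_vector_derivative_bound[OF has_vector_derivative_diff[OF dJ[OF that(1)] dJ[OF that(2)]],
          of "L * dist f g" 0 t] that e by simp
  qed
  define T where "T f = Bcontfun (\<lambda>t. x0 + (J f (\<tau> t) - J f 0))" for f
  have T: "apply_bcontfun (T f) t = x0 + (J f (\<tau> t) - J f 0)" if "f \<in> K" for f t
  proof -
    have "continuous_on {-e..e} (J f)"
      unfolding continuous_on_eq_continuous_within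
      using has_vector_derivative_continuous[OF dJ[OF that]] by blast
    then have "continuous_on UNIV (\<lambda>t. J f (\<tau> t))"
      by (rule continuous_on_compose2) (use \<tau> in \<open>auto simp: \<tau>_def intro!: continuous_intros\<close>)
    moreover have "norm (x0 + (J f (\<tau> t) - J f 0)) \<le> norm x0 + M * e" for t
      using order_trans[OF boundJ[OF that \<tau>(1)[of t]] mult_left_mono[OF \<tau>(2) M]]
        norm_triangle_ineq[of x0 "J f (\<tau> t) - J f 0"] by simp
    ultimately have "(\<lambda>t. x0 + (J f (\<tau> t) - J f 0)) \<in> bcontfun"
      by (intro bcontfun_normI) (auto intro!: continuous_intros)
    then show ?thesis by (simp add: T_def Bcontfun_inverse)
  qed
  have "\<exists>!f\<in>K. T f = f"
  proof (rule Banach_fix)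
    show "complete K"
      unfolding K_def by (intro complete_eq_closed[THEN iffD2] closed_PiC) auto
    have "const_bcontfun x0 \<in> K" using \<open>0 < r\<close> by (auto simp: K_def mem_PiC_iff const_bcontfun.rep_eq)
    then show "K \<noteq> {}" by blast
    show "T ` K \<subseteq> K"
    proof safe
      fix f assume f: "f \<in> K"
      have "norm (J f (\<tau> t) - J f 0) \<le> r" for t
        using order_trans[OF boundJ[OF f \<tau>(1)[of t]] mult_left_mono[OF \<tau>(2) M]] eM by fastforce
      then show "T f \<in> K"
        by (auto simp: K_def mem_PiC_iff T[OF f] dist_norm norm_minus_commute)
    qed
    show "dist (T f) (T g) \<le> 1 / 2 * dist f g" if "f \<in> K" "g \<in> K" for f g
    proof (rule dist_bound)
      fix t
      have "dist (apply_bcontfun (T f) t) (apply_bcontfun (T g) t) \<le> L * dist f g * \<bar>\<tau> t\<bar>"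
        using lipJ[of f g "\<tau> t"] that \<tau> by (simp add: T dist_norm algebra_simps)
      also have "\<dots> \<le> L * dist f g * e" using \<tau>(2) L by (intro mult_left_mono) auto
      also have "\<dots> = L * e * dist f g" by simp
      also have "\<dots> \<le> 1 / 2 * dist f g" using eL by (intro mult_right_mono) auto
      finally show "dist (apply_bcontfun (T f) t) (apply_bcontfun (T g) t) \<le> 1 / 2 * dist f g" .
    qed
  qed auto
  then obtain X where X: "X \<in> K" "T X = X" by blast
  show ?thesis
  proof (rule that[OF e, of "apply_bcontfun X"])
    have eq: "apply_bcontfun X t = x0 + (J X (\<tau> t) - J X 0)" for t using T X by metis
    then show "apply_bcontfun X 0 = x0" using e by (simp add: \<tau>_def)
    show "\<forall>t\<in>{-e<..<e}. apply_bcontfun X t \<in> cball x0 r \<and>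
        (apply_bcontfun X has_vector_derivative H (apply_bcontfun X t)) (at t)"
    proof
      fix t assume t: "t \<in> {-e<..<e}"
      \<comment> \<open>At interior times the derivative within the interval is a full derivative
        and the clamping is the identity, so the fixed point solves the differential
        equation.\<close>
      have "at t within {-e..e} = at t"
        using t by (intro at_within_interior) simp
      then have "(J X has_vector_derivative H (apply_bcontfun X t)) (at t)"
        using dJ[OF X(1), of t] t by simp
      then have "((\<lambda>t. x0 + (J X t - J X 0)) has_vector_derivative H (apply_bcontfun X t)) (at t)"
        by (auto intro!: derivative_eq_intros)
      then have "(apply_bcontfun X has_vector_derivative H (apply_bcontfun X t)) (at t)"
        by (rule has_vector_derivative_transform_within_open[of _ _ _ "{-e<..<e}"])
          (use t eq in \<open>auto simp: \<tau>_def\<close>)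
      then show "apply_bcontfun X t \<in> cball x0 r \<and>
          (apply_bcontfun X has_vector_derivative H (apply_bcontfun X t)) (at t)"
        using KD[OF X(1)] by blast
    qed
  qed
qed

text \<open>Continuity of the derivative is known for each fixed direction. On a compact ball this
  bounds the derivative on every basis vector, and the sum of these finitely many bounds dominates
  the operator norm.\<close>

lemma k_smooth_on_locally_lipschitz:
  fixes H :: "'a::euclidean_space \<Rightarrow> 'b::real_normed_vector"
  assumes "open S" "x \<in> S" and H: "k_smooth_on (Suc 0) S H"
  obtains r L where "0 < r" "cball x r \<subseteq> S" "L-lipschitz_on (cball x r) H"
proof -
  obtain r where r: "0 < r" "cball x r \<subseteq> S" using assms open_contains_cball by blast
  define D where "D p = frechet_derivative H (at p)" for p
  have "\<exists>B. \<forall>p\<in>cball x r. norm (D p i) \<le> B" for i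
  proof -
    have "continuous_on (cball x r) (\<lambda>p. D p i)"
      unfolding D_def by (rule continuous_on_subset[OF _ r(2)]) (use H in simp)
    then have "bounded ((\<lambda>p. D p i) ` cball x r)"
      by (intro compact_imp_bounded compact_continuous_image) auto
    then show ?thesis by (auto simp: bounded_iff)
  qed
  then obtain B where B: "\<And>i p. p \<in> cball x r \<Longrightarrow> norm (D p i) \<le> B i" by metis
  have B0: "0 \<le> B i" for i using order_trans[OF norm_ge_zero B[of x i]] r by simp
  have on: "onorm (D p) \<le> (\<Sum>i\<in>Basis. B i)" if p: "p \<in> cball x r" for p
  proof (rule onorm_bound)
    have "bounded_linear (D p)"
      unfolding D_def by (rule has_derivative_bounded_linear[OF k_smooth_on_has_derivative[OF H]])
        (use p r(2) in blast)
    then have lin: "linear (D p)" by (rule bounded_linear.linear)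
    fix h :: 'a
    have "norm (D p h) = norm (\<Sum>i\<in>Basis. (h \<bullet> i) *\<^sub>R D p i)"
      by (subst euclidean_representation[symmetric, of h]) (simp add: linear_sum[OF lin] linear_scale[OF lin])
    also have "\<dots> \<le> (\<Sum>i\<in>Basis. \<bar>h \<bullet> i\<bar> * norm (D p i))" by (rule order_trans[OF norm_sum]) simp
    also have "\<dots> \<le> (\<Sum>i\<in>Basis. norm h * B i)"
      using B[OF p] by (intro sum_mono mult_mono) (auto simp: Basis_le_norm)
    finally show "norm (D p h) \<le> (\<Sum>i\<in>Basis. B i) * norm h" by (simp add: sum_distrib_left mult.commute)
  qed (auto intro: sum_nonneg B0)
  have "(\<Sum>i\<in>Basis. B i)-lipschitz_on (cball x r) H"
  proof (rule lipschitz_onI)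
    have "(H has_derivative D p) (at p within cball x r)" if "p \<in> cball x r" for p
      unfolding D_def
      by (rule has_derivative_at_withinI[OF k_smooth_on_has_derivative[OF H]]) (use that r(2) in blast)
    then show "dist (H p) (H q) \<le> (\<Sum>i\<in>Basis. B i) * dist p q"
      if "p \<in> cball x r" "q \<in> cball x r" for p q
      unfolding dist_norm by (rule differentiable_bound[OF convex_cball _ on]) (use that in auto)
  qed (intro sum_nonneg B0)
  then show ?thesis using that r by blast
qed

text \<open>The norm of \<open>c'\<close> satisfies the same linear equation as \<open>c'\<close>
  itself, so their quotient \<open>u\<close> has derivative zero. This replaces an explicit change
  of parameter to arc length.\<close>

lemma collinear_image_if_acceleration_parallel:
  fixes c :: "real \<Rightarrow> 'a::euclidean_space"
  assumes I: "open I" "is_interval I"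
    and c: "\<And>t. t \<in> I \<Longrightarrow> (c has_vector_derivative c' t) (at t)"
    and c': "\<And>t. t \<in> I \<Longrightarrow> (c' has_vector_derivative p t *\<^sub>R c' t) (at t)"
    and nz: "\<And>t. t \<in> I \<Longrightarrow> c' t \<noteq> 0"
  shows "collinear (c ` I)"
proof (cases "I = {}")
  case False
  then obtain t0 where t0: "t0 \<in> I" by blast
  have const: "f t = f t0" if "t \<in> I" "\<And>t. t \<in> I \<Longrightarrow> (f has_vector_derivative 0) (at t)" for f :: "real \<Rightarrow> 'a" and t
    using has_derivative_zero_unique[of I f t0 t] that t0 I
    by (force simp: has_vector_derivative_def is_interval_convex intro: has_derivative_at_withinI)
  define u where "u t = (1 / norm (c' t)) *\<^sub>R c' t" for t
  have "(u has_vector_derivative 0) (at t)" if "t \<in> I" for t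
  proof -
    have "((\<lambda>t. norm (c' t)) has_real_derivative p t * norm (c' t)) (at t)"
      using has_derivative_compose[OF c'[OF that, unfolded has_vector_derivative_def] has_derivative_norm[OF nz[OF that]]]
        nz[OF that]
      by (simp add: has_field_derivative_def sgn_div_norm dot_square_norm power2_eq_square mult_ac mult_commute_abs)
    then have "((\<lambda>t. 1 / norm (c' t)) has_real_derivative - p t / norm (c' t)) (at t)"
      using nz[OF that] by (auto intro!: derivative_eq_intros simp: power2_eq_square)
    from has_vector_derivative_scaleR[OF this c'[OF that]] show ?thesis
      by (simp add: u_def[abs_def])
  qed
  then have u: "u t = u t0" if "t \<in> I" for t using const that by blast
  define v where "v = u t0"
  have v: "v \<bullet> v = 1" using nz[OF t0] by (simp add: v_def u_def dot_square_norm power2_eq_square)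
  have c'v: "c' t = norm (c' t) *\<^sub>R v" if "t \<in> I" for t
    unfolding v_def u[OF that, symmetric] using nz[OF that] by (simp add: u_def)
  \<comment> \<open>The part of \<open>c\<close> orthogonal to the constant direction
    \<open>v\<close> does not move, so every chord is a multiple of \<open>v\<close>.\<close>
  have "((\<lambda>t. c t - (c t \<bullet> v) *\<^sub>R v) has_vector_derivative 0) (at t)" if "t \<in> I" for t
  proof -
    have "((\<lambda>t. c t - (c t \<bullet> v) *\<^sub>R v) has_vector_derivative (c' t - (c' t \<bullet> v) *\<^sub>R v)) (at t)"
      using c[OF that] unfolding has_vector_derivative_def
      by (auto intro!: derivative_eq_intros simp: algebra_simps)
    moreover have "c' t - (c' t \<bullet> v) *\<^sub>R v = 0"
      using c'v[OF that] v by (metis inner_scaleR_left mult.right_neutral right_minus_eq)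
    ultimately show ?thesis by simp
  qed
  then have k: "c t - (c t \<bullet> v) *\<^sub>R v = c t0 - (c t0 \<bullet> v) *\<^sub>R v" if "t \<in> I" for t
    using const[of t "\<lambda>t. c t - (c t \<bullet> v) *\<^sub>R v"] that by blast
  have "c s - c t = (c s \<bullet> v - c t \<bullet> v) *\<^sub>R v" if "s \<in> I" "t \<in> I" for s t
    using trans[OF k[OF that(1)] k[OF that(2), symmetric]] by (simp add: algebra_simps)
  then show ?thesis unfolding collinear_def by blast
qed simp

text \<open>A linear map that annihilates the direction of the line is constant along
  \<open>c\<close>; differentiating twice, it annihilates velocity and acceleration as well, so both
  lie on the line through 0 in that direction.\<close>

lemma acceleration_parallel_if_collinear_image:
  fixes c :: "real \<Rightarrow> 'a::euclidean_space"
  assumes I: "open I" "t \<in> I" and col: "collinear (c ` I)"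
    and c: "\<And>s. s \<in> I \<Longrightarrow> (c has_vector_derivative c' s) (at s)"
    and c': "(c' has_vector_derivative w) (at t)" and nz: "c' t \<noteq> 0"
  shows "\<exists>k. w = k *\<^sub>R c' t"
proof -
  obtain u where u: "\<And>s t. s \<in> I \<Longrightarrow> t \<in> I \<Longrightarrow> \<exists>k. c s - c t = k *\<^sub>R u"
    using col unfolding collinear_def by blast
  \<comment> \<open>The orthogonal projection off \<open>u\<close>, scaled by
    \<open>u \<bullet> u\<close>: free of division, it can be used before \<open>u\<close> is known
    to be nonzero.\<close>
  define P where "P z = (u \<bullet> u) *\<^sub>R z - (z \<bullet> u) *\<^sub>R u" for z :: 'a
  have P: "bounded_linear P" unfolding P_def by (intro bounded_linear_intros)
  have const: "P d = 0"
    if "\<And>s. s \<in> I \<Longrightarrow> P (f s) = P (f r)" "(f has_vector_derivative d) (at r)" "r \<in> I" for f d r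
  proof -
    have "((\<lambda>s. P (f s)) has_vector_derivative P d) (at r)"
      by (rule bounded_linear.has_vector_derivative[OF P that(2)])
    moreover have "((\<lambda>s. P (f s)) has_vector_derivative 0) (at r)"
      by (rule has_vector_derivative_transform_within_open[OF has_vector_derivative_const \<open>open I\<close> that(3)])
        (rule that(1)[symmetric])
    ultimately show ?thesis by (rule vector_derivative_unique_at)
  qed
  have Pc: "P (c s) = P (c r)" if "s \<in> I" "r \<in> I" for s r
  proof -
    obtain k where k: "c s - c r = k *\<^sub>R u" using u \<open>s \<in> I\<close> \<open>r \<in> I\<close> by blast
    have "P (c s) - P (c r) = P (c s - c r)" by (simp add: linear_diff bounded_linear.linear[OF P])
    also have "\<dots> = 0" by (simp add: k P_def)
    finally show ?thesis by simp
  qed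
  have Pc': "P (c' r) = 0" if "r \<in> I" for r
    by (rule const[of c r, OF Pc c]) (use that in auto)
  have Pw: "P w = 0"
    by (rule const[of c' t, OF _ c' I(2)]) (simp add: Pc' I(2))
  \<comment> \<open>A zero direction would make the curve constant, against the nonzero
    velocity.\<close>
  have "u \<noteq> 0"
  proof
    assume "u = 0"
    then have "c s = c t" if "s \<in> I" for s using u[OF that I(2)] by auto
    then have "(c has_vector_derivative 0) (at t)"
      by (intro has_vector_derivative_transform_within_open[OF has_vector_derivative_const I, of "c t"]) simp
    then show False using nz c[OF I(2)] vector_derivative_unique_at by blast
  qed
  then have uu: "u \<bullet> u \<noteq> 0" by simp
  have y: "(u \<bullet> u) *\<^sub>R c' t = (c' t \<bullet> u) *\<^sub>R u" and ww: "(u \<bullet> u) *\<^sub>R w = (w \<bullet> u) *\<^sub>R u"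
    using Pc'[OF I(2)] Pw by (simp_all add: P_def)
  have yu: "c' t \<bullet> u \<noteq> 0" using y uu nz by force
  have "(u \<bullet> u) *\<^sub>R ((w \<bullet> u / (c' t \<bullet> u)) *\<^sub>R c' t) = (w \<bullet> u / (c' t \<bullet> u)) *\<^sub>R ((c' t \<bullet> u) *\<^sub>R u)"
    unfolding y[symmetric] by (simp add: mult.commute)
  also have "\<dots> = (u \<bullet> u) *\<^sub>R w" using yu ww by simp
  finally have "w = (w \<bullet> u / (c' t \<bullet> u)) *\<^sub>R c' t" using uu by (simp only: scaleR_cancel_left) auto
  then show ?thesis by blast
qed

section \<open>Sprays and the Euler--Lagrange expression\<close>

lemma k_smooth_on_bounded_linear_comp:
  assumes "open S" "bounded_linear L"
  shows "k_smooth_on k S f \<Longrightarrow> k_smooth_on k S (\<lambda>x. L (f x))"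
proof (induction k arbitrary: f)
  case 0
  then show ?case using bounded_linear.continuous_on[OF assms(2)] by auto
next
  case (Suc k)
  show ?case
    by (rule k_smooth_on_SucI[OF assms(1) bounded_linear.has_derivative[OF assms(2)
          Suc.prems[THEN k_smooth_on_has_derivative]]])
      (use Suc in auto)
qed

text \<open>\<open>matrix_inv\<close> is defined by choice; its two equations hold because some
  two-sided inverse exists.\<close>

lemma matrix_inv_mult:
  fixes A :: "real^'n^'n"
  assumes "invertible A"
  shows "A ** matrix_inv A = mat 1" "matrix_inv A ** A = mat 1"
proof -
  have "\<exists>B. A ** B = mat 1 \<and> B ** A = mat 1" using assms by (simp add: invertible_def)
  from someI_ex[OF this] show "A ** matrix_inv A = mat 1" "matrix_inv A ** A = mat 1"
    by (simp_all add: matrix_inv_def)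
qed

lemma matrix_inv_mult_vector:
  fixes A :: "real^'n^'n"
  assumes "invertible A"
  shows "A *v (matrix_inv A *v v) = v" "matrix_inv A *v (A *v v) = v"
  by (simp_all add: matrix_vector_mul_assoc matrix_inv_mult[OF assms])

lemma invertible_if_positive_definite:
  fixes A :: "real^'n^'n"
  assumes "\<And>v. v \<noteq> 0 \<Longrightarrow> 0 < v \<bullet> (A *v v)"
  shows "invertible A"
proof -
  have "v = 0" if "A *v v = 0" for v using assms[of v] that by fastforce
  then have "\<exists>B. B ** A = mat 1" by (simp add: matrix_left_invertible_ker)
  then show ?thesis using invertible_left_inverse by blast
qed

lemma pd_has_derivative:
  "(f has_derivative f') (at x) \<Longrightarrow> pd k f x = f' (axis k 1)"
  unfolding pd_def using frechet_derivative_at by metis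

text \<open>The passage from index notation to directional derivatives: a sum of partial derivatives
  weighted by the components of \<open>v\<close> is one Frechet derivative in the direction
  \<open>v\<close>.\<close>

lemma linear_sum_axis:
  fixes f :: "real^'n \<Rightarrow> 'b::real_vector"
  assumes "linear f"
  shows "(\<Sum>k\<in>UNIV. v $ k *\<^sub>R f (axis k 1)) = f v"
  by (subst (2) basis_expansion[symmetric, of v])
    (simp add: linear_sum[OF assms] linear_scale[OF assms] scalar_mult_eq_scaleR)

lemma sum_pd:
  assumes "f differentiable (at x)"
  shows "(\<Sum>k\<in>UNIV. pd k f x * v $ k) = frechet_derivative f (at x) v"
  using linear_sum_axis[OF linear_frechet_derivative[OF assms], of v]
  by (simp add: pd_def mult.commute)

lemma has_derivative_fst_arg:
  assumes "(h has_derivative h') (at (x, y))"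
  shows "((\<lambda>z. h (z, y)) has_derivative (\<lambda>v. h' (v, 0))) (at x)"
proof (rule has_derivative_compose[of "\<lambda>z. (z, y)" "\<lambda>v. (v, 0)", OF _ assms])
  show "((\<lambda>z. (z, y)) has_derivative (\<lambda>v. (v, 0))) (at x)"
    by (intro has_derivative_Pair has_derivative_const has_derivative_ident)
qed

lemma has_derivative_snd_arg:
  assumes "(h has_derivative h') (at (x, y))"
  shows "((\<lambda>w. h (x, w)) has_derivative (\<lambda>v. h' (0, v))) (at y)"
proof (rule has_derivative_compose[of "\<lambda>w. (x, w)" "\<lambda>v. (0, v)", OF _ assms])
  show "((\<lambda>w. (x, w)) has_derivative (\<lambda>v. (0, v))) (at y)"
    by (intro has_derivative_Pair has_derivative_const has_derivative_ident)
qed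

text \<open>The sum over $k$ in the mixed term is absorbed into a single base derivative in the
  direction \<open>y\<close>, taken while the fibre argument stays fixed at
  \<open>y\<close>.\<close>

definition euler_lagrange ::
    "(real^'n \<Rightarrow> real^'n \<Rightarrow> real) \<Rightarrow> real^'n \<Rightarrow> real^'n \<Rightarrow> real^'n" where
  "euler_lagrange L x y =
     (\<chi> l. frechet_derivative (\<lambda>z. pd l (L z) y) (at x) y - pd l (\<lambda>z. L z y) x)"

text \<open>The hypotheses concern $F^2$ only, so that they hold for a Riemannian norm without differentiating
  a square root.\<close>

context
  fixes U :: "(real^'n) set" and F :: "real^'n \<Rightarrow> real^'n \<Rightarrow> real" and Q dQ D2
  assumes open_U: "open U"
    and smooth_sq: "smooth_on (U \<times> (- {0})) (\<lambda>p. (F (fst p) (snd p))\<^sup>2)"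
    and homogeneous_sq: "\<And>x y t. x \<in> U \<Longrightarrow> t > 0 \<Longrightarrow> (F x (t *\<^sub>R y))\<^sup>2 = t\<^sup>2 * (F x y)\<^sup>2"
  defines "Q \<equiv> \<lambda>x y. (F x y)\<^sup>2"
    and "dQ \<equiv> \<lambda>u p. frechet_derivative (\<lambda>p. Q (fst p) (snd p)) (at p) u"
    and "D2 \<equiv> \<lambda>u v p. frechet_derivative (dQ u) (at p) v"
begin

lemma open_slit: "open (U \<times> (- {0 :: real^'n}))"
  using open_U by (intro open_Times) auto

lemma smooth_Q: "smooth_on (U \<times> (- {0})) (\<lambda>p. Q (fst p) (snd p))"
  using smooth_sq by (simp add: Q_def)

lemma smooth_dQ: "smooth_on (U \<times> (- {0})) (dQ u)"
  unfolding dQ_def by (rule smooth_on_frechet_derivative[OF smooth_Q])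

lemma smooth_D2: "smooth_on (U \<times> (- {0})) (D2 u v)"
  unfolding D2_def by (rule smooth_on_frechet_derivative[OF smooth_dQ])

lemma Q_deriv:
  assumes "x \<in> U" "y \<noteq> 0"
  shows "((\<lambda>p. Q (fst p) (snd p)) has_derivative (\<lambda>u. dQ u (x, y))) (at (x, y))"
  unfolding dQ_def using assms by (intro smooth_on_has_derivative[OF smooth_Q]) auto

lemma Q_deriv_snd:
  assumes "x \<in> U" "y \<noteq> 0"
  shows "(Q x has_derivative (\<lambda>v. dQ (0, v) (x, y))) (at y)"
  using has_derivative_snd_arg[OF Q_deriv[OF assms]] by simp

lemma dQ_deriv:
  assumes "x \<in> U" "y \<noteq> 0"
  shows "(dQ u has_derivative (\<lambda>v. D2 u v (x, y))) (at (x, y))"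
  unfolding D2_def using assms by (intro smooth_on_has_derivative[OF smooth_dQ]) auto

lemma D2_commute: "x \<in> U \<Longrightarrow> y \<noteq> 0 \<Longrightarrow> D2 u v (x, y) = D2 v u (x, y)"
  unfolding D2_def dQ_def by (intro frechet_derivative_commute[OF open_slit _ smooth_Q]) auto

lemma pd_Q_snd: "x \<in> U \<Longrightarrow> y \<noteq> 0 \<Longrightarrow> pd i (Q x) y = dQ (0, axis i 1) (x, y)"
  by (rule pd_has_derivative[OF Q_deriv_snd])

lemma fundamental_tensor_eq:
  assumes "x \<in> U" "y \<noteq> 0"
  shows "fundamental_tensor F x y $ i $ j = 1/2 * D2 (0, axis i 1) (0, axis j 1) (x, y)"
proof -
  have "((\<lambda>w. dQ (0, axis i 1) (x, w)) has_derivative (\<lambda>v. D2 (0, axis i 1) (0, v) (x, y))) (at y)"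
    by (rule has_derivative_snd_arg[OF dQ_deriv[OF assms]])
  then have "((\<lambda>w. pd i (Q x) w) has_derivative (\<lambda>v. D2 (0, axis i 1) (0, v) (x, y))) (at y)"
    by (rule has_derivative_transform_within_open[of _ _ _ _ "- {0}"])
      (use assms pd_Q_snd in auto)
  then show ?thesis
    by (simp add: fundamental_tensor_def pd_has_derivative Q_def)
qed

lemma fundamental_tensor_sym:
  "x \<in> U \<Longrightarrow> y \<noteq> 0 \<Longrightarrow> fundamental_tensor F x y $ i $ j = fundamental_tensor F x y $ j $ i"
  by (simp add: fundamental_tensor_eq D2_commute)

text \<open>Euler's relation for degree 2: the derivative of \<open>Q x (t *\<^sub>R y)\<close> at
  \<open>t = 1\<close> is computed by the chain rule and from homogeneity.\<close>

lemma Q_euler: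
  assumes "x \<in> U" "y \<noteq> 0"
  shows "dQ (0, y) (x, y) = 2 * Q x y"
proof -
  have "((\<lambda>t. Q x (t *\<^sub>R y)) has_derivative (\<lambda>k. dQ (0, k *\<^sub>R y) (x, y))) (at 1)"
  proof (rule has_derivative_compose[of "\<lambda>t. t *\<^sub>R y"])
    show "(Q x has_derivative (\<lambda>v. dQ (0, v) (x, y))) (at (1 *\<^sub>R y))"
      using Q_deriv_snd[OF assms] by simp
  qed (auto intro!: derivative_eq_intros)
  moreover have "((\<lambda>t. Q x (t *\<^sub>R y)) has_derivative (\<lambda>k. k * (2 * Q x y))) (at 1)"
  proof (rule has_derivative_transform_within_open[of _ _ _ _ "{0<..}"])
    show "((\<lambda>t. t\<^sup>2 * Q x y) has_derivative (\<lambda>k. k * (2 * Q x y))) (at (1 :: real))"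
      by (auto intro!: derivative_eq_intros)
  qed (use assms homogeneous_sq in \<open>auto simp: Q_def\<close>)
  ultimately have "(\<lambda>k. dQ (0, k *\<^sub>R y) (x, y)) = (\<lambda>k. k * (2 * Q x y))"
    by (rule has_derivative_unique)
  from fun_cong[OF this, of 1] show ?thesis by simp
qed

text \<open>Differentiate Euler's relation $w^i Q_{y^i} = 2 Q$ along the fibre in the direction
  \<open>v\<close>: the product rule on the left yields $Q_v$ once more, which cancels one of the
  two copies on the right.\<close>

lemma D2_contract:
  assumes "x \<in> U" "y \<noteq> 0"
  shows "(\<Sum>i\<in>UNIV. y $ i * D2 (0, axis i 1) (0, v) (x, y)) = dQ (0, v) (x, y)"
proof -
  have lin: "(\<Sum>i\<in>UNIV. w $ i * dQ (0, axis i 1) (x, z)) = dQ (0, w) (x, z)" if "z \<noteq> 0" for z w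
    using linear_sum_axis[OF has_derivative_linear[OF Q_deriv_snd[OF assms(1) that]], of w]
    by simp
  have "((\<lambda>w. dQ u (x, w)) has_derivative (\<lambda>v. D2 u (0, v) (x, y))) (at y)" for u
    by (rule has_derivative_snd_arg[OF dQ_deriv[OF assms]])
  then have "((\<lambda>w. \<Sum>i\<in>UNIV. w $ i * dQ (0, axis i 1) (x, w)) has_derivative
      (\<lambda>v. \<Sum>i\<in>UNIV. y $ i * D2 (0, axis i 1) (0, v) (x, y) + v $ i * dQ (0, axis i 1) (x, y))) (at y)"
    by (intro has_derivative_sum has_derivative_mult bounded_linear_imp_has_derivative bounded_linear_vec_nth)
  moreover have "((\<lambda>w. \<Sum>i\<in>UNIV. w $ i * dQ (0, axis i 1) (x, w)) has_derivative
      (\<lambda>v. 2 * dQ (0, v) (x, y))) (at y)"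
  proof (rule has_derivative_transform_within_open[of _ _ _ _ "- {0}"])
    show "((\<lambda>w. 2 * Q x w) has_derivative (\<lambda>v. 2 * dQ (0, v) (x, y))) (at y)"
      by (intro has_derivative_mult_right Q_deriv_snd[OF assms])
  qed (use assms lin Q_euler in auto)
  ultimately have "(\<lambda>v. \<Sum>i\<in>UNIV. y $ i * D2 (0, axis i 1) (0, v) (x, y) + v $ i * dQ (0, axis i 1) (x, y))
      = (\<lambda>v. 2 * dQ (0, v) (x, y))"
    by (rule has_derivative_unique)
  from fun_cong[OF this, of v] show ?thesis
    using lin[OF assms(2), of v] by (simp add: sum.distrib)
qed

lemma fundamental_tensor_contract:
  assumes "x \<in> U" "y \<noteq> 0"
  shows "(\<Sum>i\<in>UNIV. fundamental_tensor F x y $ i $ j * y $ i) = 1/2 * pd j (Q x) y"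
proof -
  have "(\<Sum>i\<in>UNIV. fundamental_tensor F x y $ i $ j * y $ i)
      = (\<Sum>i\<in>UNIV. 1/2 * (y $ i * D2 (0, axis i 1) (0, axis j 1) (x, y)))"
    by (simp add: fundamental_tensor_eq assms mult_ac)
  then show ?thesis
    using D2_contract[OF assms, of "axis j 1"] by (simp add: sum_divide_distrib[symmetric] pd_Q_snd assms)
qed

lemma fundamental_tensor_mult_vector:
  assumes "x \<in> U" "y \<noteq> 0"
  shows "fundamental_tensor F x y *v y = (\<chi> l. 1/2 * pd l (Q x) y)"
  using fundamental_tensor_contract[OF assms]
  by (simp add: matrix_vector_mult_def vec_eq_iff fundamental_tensor_sym[OF assms, of l for l])

text \<open>Exhibits the base derivative of $g_{ij}$ as a third derivative of \<open>Q\<close> on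
  the slit bundle, the form in which the smoothness of the spray can be read off.\<close>

lemma fundamental_tensor_fst_deriv:
  assumes "x \<in> U" "y \<noteq> 0"
  shows "((\<lambda>z. fundamental_tensor F z y $ i $ j) has_derivative
     (\<lambda>v. 1/2 * frechet_derivative (D2 (0, axis i 1) (0, axis j 1)) (at (x, y)) (v, 0))) (at x)"
proof (rule has_derivative_transform_within_open[OF _ open_U assms(1)])
  have "(D2 u v has_derivative frechet_derivative (D2 u v) (at (x, y))) (at (x, y))" for u v
    using assms by (intro smooth_on_has_derivative[OF smooth_D2]) auto
  then show "((\<lambda>z. 1/2 * D2 (0, axis i 1) (0, axis j 1) (z, y)) has_derivative
     (\<lambda>v. 1/2 * frechet_derivative (D2 (0, axis i 1) (0, axis j 1)) (at (x, y)) (v, 0))) (at x)"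
    by (intro has_derivative_mult_right has_derivative_fst_arg)
qed (use assms in \<open>simp add: fundamental_tensor_eq\<close>)

lemma pd_fundamental_tensor:
  assumes "x \<in> U" "y \<noteq> 0"
  shows "pd k (\<lambda>z. fundamental_tensor F z y $ i $ j) x
    = 1/2 * frechet_derivative (D2 (0, axis i 1) (0, axis j 1)) (at (x, y)) (axis k 1, 0)"
  by (rule pd_has_derivative[OF fundamental_tensor_fst_deriv[OF assms]])

text \<open>Contraction with the fixed vector \<open>y\<close> commutes with base derivatives. Since
  $g_{jl} y^j = Q_{y^l}/2$, each of the two positive terms gives half of $Q_{x^k y^l} y^k$; since
  $g_{jk} y^j y^k = Q$, the negative term gives $Q_{x^l}$.\<close>

lemma spray_bracket:
  assumes "x \<in> U" "y \<noteq> 0"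
  shows "(\<Sum>j\<in>UNIV. \<Sum>k\<in>UNIV.
        (pd k (\<lambda>z. fundamental_tensor F z y $ j $ l) x
         + pd j (\<lambda>z. fundamental_tensor F z y $ l $ k) x
         - pd l (\<lambda>z. fundamental_tensor F z y $ j $ k) x) * y $ j * y $ k)
    = euler_lagrange Q x y $ l"
proof -
  let ?g = "fundamental_tensor F"
  define dg where "dg j l = frechet_derivative (\<lambda>z. ?g z y $ j $ l) (at x)" for j l
  have diff: "(\<lambda>z. ?g z y $ j $ l) differentiable (at x)" for j l
    using fundamental_tensor_fst_deriv[OF assms] differentiable_def by blast
  then have dg: "((\<lambda>z. ?g z y $ j $ l) has_derivative dg j l) (at x)" for j l
    by (simp add: dg_def frechet_derivative_works)
  have contr: "((\<lambda>z. \<Sum>j\<in>UNIV. ?g z y $ j $ l * y $ j) has_derivative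
      (\<lambda>v. \<Sum>j\<in>UNIV. dg j l v * y $ j)) (at x)" for l
    by (intro has_derivative_sum has_derivative_mult_left dg)
  have half: "((\<lambda>z. 1/2 * pd l (Q z) y) has_derivative (\<lambda>v. \<Sum>j\<in>UNIV. dg j l v * y $ j)) (at x)" for l
    by (rule has_derivative_transform_within_open[OF contr open_U assms(1)])
      (simp add: fundamental_tensor_contract assms)
  have "((\<lambda>z. pd l (Q z) y) has_derivative (\<lambda>v. 2 * (\<Sum>j\<in>UNIV. dg j l v * y $ j))) (at x)" for l
    using has_derivative_mult_right[OF half, of 2 l] by simp
  then have A: "frechet_derivative (\<lambda>z. pd l (Q z) y) (at x) v = 2 * (\<Sum>j\<in>UNIV. dg j l v * y $ j)" for l v
    by (rule fun_cong[OF frechet_derivative_at[symmetric]])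
  have "((\<lambda>z. \<Sum>k\<in>UNIV. (\<Sum>j\<in>UNIV. ?g z y $ j $ k * y $ j) * y $ k) has_derivative
      (\<lambda>v. \<Sum>k\<in>UNIV. (\<Sum>j\<in>UNIV. dg j k v * y $ j) * y $ k)) (at x)"
    by (intro has_derivative_sum has_derivative_mult_left dg)
  then have "((\<lambda>z. Q z y) has_derivative (\<lambda>v. \<Sum>k\<in>UNIV. (\<Sum>j\<in>UNIV. dg j k v * y $ j) * y $ k)) (at x)"
  proof (rule has_derivative_transform_within_open[OF _ open_U assms(1)])
    fix z assume z: "z \<in> U"
    have "(\<Sum>k\<in>UNIV. (\<Sum>j\<in>UNIV. ?g z y $ j $ k * y $ j) * y $ k)
        = 1/2 * (\<Sum>k\<in>UNIV. y $ k * dQ (0, axis k 1) (z, y))"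
      unfolding fundamental_tensor_contract[OF z assms(2)] pd_Q_snd[OF z assms(2)]
      by (simp add: sum_distrib_left mult_ac)
    also have "\<dots> = 1/2 * dQ (0, y) (z, y)"
      using linear_sum_axis[OF has_derivative_linear[OF Q_deriv_snd[OF z assms(2)]], of y]
      by simp
    also have "\<dots> = Q z y" by (simp add: Q_euler z assms)
    finally show "(\<Sum>k\<in>UNIV. (\<Sum>j\<in>UNIV. ?g z y $ j $ k * y $ j) * y $ k) = Q z y" .
  qed
  then have B: "pd l (\<lambda>z. Q z y) x = (\<Sum>k\<in>UNIV. (\<Sum>j\<in>UNIV. dg j k (axis l 1) * y $ j) * y $ k)"
    by (rule pd_has_derivative)
  \<comment> \<open>The second term of the bracket carries the free index \<open>l\<close> in first
    place; symmetry lets it be contracted like the first term.\<close>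
  have dgsym: "dg j l = dg l j" for j l
    unfolding dg_def
    by (rule frechet_derivative_transform_within_open[OF diff open_U assms(1)])
      (simp add: fundamental_tensor_sym assms)
  have pdg: "pd k (\<lambda>z. ?g z y $ j $ l) x = dg j l (axis k 1)" for j k l
    by (simp add: pd_def dg_def)
  have sumdg: "(\<Sum>k\<in>UNIV. dg j l (axis k 1) * y $ k) = dg j l y" for j l
    using linear_sum_axis[OF has_derivative_linear[OF dg], of y] by (simp add: mult.commute)
  have "(\<Sum>j\<in>UNIV. \<Sum>k\<in>UNIV. dg j l (axis k 1) * y $ j * y $ k) = (\<Sum>j\<in>UNIV. dg j l y * y $ j)"
    by (simp add: sumdg[symmetric] sum_distrib_left mult_ac)
  moreover have "(\<Sum>j\<in>UNIV. \<Sum>k\<in>UNIV. dg l k (axis j 1) * y $ j * y $ k) = (\<Sum>j\<in>UNIV. dg j l y * y $ j)"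
    by (subst sum.swap) (simp add: sumdg[symmetric] dgsym[of l] sum_distrib_left mult_ac)
  moreover have "(\<Sum>j\<in>UNIV. \<Sum>k\<in>UNIV. dg j k (axis l 1) * y $ j * y $ k)
      = (\<Sum>k\<in>UNIV. (\<Sum>j\<in>UNIV. dg j k (axis l 1) * y $ j) * y $ k)"
    by (subst sum.swap) (simp add: sum_distrib_right)
  ultimately show ?thesis
    by (simp add: pdg euler_lagrange_def A B ring_distribs sum.distrib sum_subtractf)
qed

lemma spray_eq_euler_lagrange:
  assumes "x \<in> U" "y \<noteq> 0"
  shows "spray F x y = (1/4) *\<^sub>R (matrix_inv (fundamental_tensor F x y) *v euler_lagrange Q x y)"
  by (simp add: spray_def spray_bracket[OF assms] matrix_vector_mult_def vec_eq_iff)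

text \<open>Cramer's rule writes each component of $g^{-1} E$ as a quotient of determinants whose
  entries are derivatives of \<open>Q\<close> or coordinates of \<open>y\<close>, with a denominator
  that does not vanish on the slit bundle.\<close>

lemma k_smooth_on_spray:
  assumes inv: "\<And>x y. x \<in> U \<Longrightarrow> y \<noteq> 0 \<Longrightarrow> invertible (fundamental_tensor F x y)"
  shows "k_smooth_on k (U \<times> (- {0})) (\<lambda>p. spray F (fst p) (snd p) $ i)"
proof -
  let ?S = "U \<times> (- {0 :: real^'n})"
  \<comment> \<open>\<open>G\<close> and \<open>W\<close> are the fundamental tensor and the
    Euler-Lagrange expression of \<open>Q\<close> as explicit functions of the pair
    \<open>p\<close>, in which each sign is a constant factor \<open>- 1\<close>, so that the sum
    and product rules apply.\<close>
  define G where "G p = (\<chi> i j. 1/2 * D2 (0, axis i 1) (0, axis j 1) p)" for p :: "(real^'n) \<times> (real^'n)"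
  define W where "W p = (\<chi> l. \<Sum>j\<in>UNIV. \<Sum>k\<in>UNIV.
      (1/2 * frechet_derivative (D2 (0, axis j 1) (0, axis l 1)) (at p) (axis k 1, 0)
       + 1/2 * frechet_derivative (D2 (0, axis l 1) (0, axis k 1)) (at p) (axis j 1, 0)
       + - 1 * (1/2 * frechet_derivative (D2 (0, axis j 1) (0, axis k 1)) (at p) (axis l 1, 0)))
      * snd p $ j * snd p $ k)" for p :: "(real^'n) \<times> (real^'n)"
  have G: "fundamental_tensor F (fst p) (snd p) = G p" if "p \<in> ?S" for p
    using that by (auto simp: G_def vec_eq_iff fundamental_tensor_eq)
  have W: "euler_lagrange Q (fst p) (snd p) = W p" if "p \<in> ?S" for p
    using that by (auto simp: W_def vec_eq_iff spray_bracket[symmetric] pd_fundamental_tensor)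
  have D2: "k_smooth_on k ?S (D2 u v)" for u v
    using smooth_D2 by (simp add: smooth_on_def)
  have dD2: "k_smooth_on k ?S (\<lambda>p. frechet_derivative (D2 u v) (at p) w)" for u v w
    using smooth_on_frechet_derivative[OF smooth_D2] by (simp add: smooth_on_def)
  have sG: "k_smooth_on k ?S (\<lambda>p. G p $ i $ j)" for i j
    unfolding G_def vec_lambda_beta by (intro k_smooth_on_mult k_smooth_on_const open_slit D2)
  have snd: "k_smooth_on k ?S (\<lambda>p. snd p $ j)" for j
    by (intro k_smooth_on_bounded_linear open_slit bounded_linear_compose[OF bounded_linear_vec_nth]
        bounded_linear_snd)
  have sW: "k_smooth_on k ?S (\<lambda>p. W p $ l)" for l
    unfolding W_def vec_lambda_beta
    by (intro k_smooth_on_sum k_smooth_on_mult k_smooth_on_add k_smooth_on_const open_slit snd dD2)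
  have det: "det (G p) \<noteq> 0" if "p \<in> ?S" for p
    using inv[of "fst p" "snd p"] G[OF that] that invertible_det_nz by fastforce
  have "k_smooth_on k ?S (\<lambda>p. if j = i then W p $ m else G p $ m $ j)" for m j
    using sG sW by (cases "j = i") auto
  then have sdet: "k_smooth_on k ?S (\<lambda>p. det (\<chi> m j. if j = i then W p $ m else G p $ m $ j))"
    by (intro k_smooth_on_det[OF open_slit]) (simp only: vec_lambda_beta)
  have "k_smooth_on k ?S (\<lambda>p. det (G p))"
    by (rule k_smooth_on_det[OF open_slit sG])
  then have "k_smooth_on k ?S (\<lambda>p. 1/4 *
      (det (\<chi> m j. if j = i then W p $ m else G p $ m $ j) * inverse (det (G p))))"
    by (intro k_smooth_on_mult k_smooth_on_const open_slit k_smooth_on_inverse sdet det)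
  then show ?thesis
  proof (rule k_smooth_on_cong[OF open_slit, rotated])
    fix p assume p: "p \<in> ?S"
    then have "invertible (G p)" using det invertible_det_nz by blast
    then have "G p *v (matrix_inv (G p) *v W p) = W p" by (rule matrix_inv_mult_vector)
    then have "matrix_inv (G p) *v W p
        = (\<chi> k. det (\<chi> m j. if j = k then W p $ m else G p $ m $ j) / det (G p))"
      by (rule cramer[OF det[OF p], THEN iffD1])
    then show "1/4 * (det (\<chi> m j. if j = i then W p $ m else G p $ m $ j) * inverse (det (G p)))
        = spray F (fst p) (snd p) $ i"
      using p by (subst spray_eq_euler_lagrange) (auto simp: G[OF p] W[OF p] field_simps)
  qed
qed

end


lemma differentiable_pd:
  assumes "open U" "x \<in> U" "y \<noteq> 0"
    and smooth: "smooth_on (U \<times> (- {0})) (\<lambda>p. L (fst p) (snd p))"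
  shows "(\<lambda>z. pd l (L z) y) differentiable at x"
proof -
  let ?D = "\<lambda>p. frechet_derivative (\<lambda>p. L (fst p) (snd p)) (at p) (0, axis l 1)"
  have D: "pd l (L z) y = ?D (z, y)" if "z \<in> U" for z
  proof -
    have "((\<lambda>p. L (fst p) (snd p)) has_derivative frechet_derivative (\<lambda>p. L (fst p) (snd p)) (at (z, y))) (at (z, y))"
      using that assms(3) by (intro smooth_on_has_derivative[OF smooth]) auto
    from has_derivative_snd_arg[OF this] show ?thesis by (simp add: pd_has_derivative)
  qed
  have "(?D has_derivative frechet_derivative ?D (at (x, y))) (at (x, y))"
    using assms(2,3) by (intro smooth_on_has_derivative[OF smooth_on_frechet_derivative[OF smooth]]) auto
  from has_derivative_fst_arg[OF this]
  have "((\<lambda>z. pd l (L z) y) has_derivative (\<lambda>v. frechet_derivative ?D (at (x, y)) (v, 0))) (at x)"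
    by (rule has_derivative_transform_within_open[OF _ assms(1,2)]) (simp add: D)
  then show ?thesis by (rule differentiableI)
qed

text \<open>Euler's relation $L_{y^l} y^l = L$ holds at every base point; differentiating it along
  the base in the direction \<open>y\<close> gives $L_{x^k y^l} y^k y^l = L_{x^k} y^k$.\<close>

lemma euler_lagrange_contract:
  assumes "open U" "x \<in> U" "y \<noteq> 0"
    and smooth: "smooth_on (U \<times> (- {0})) (\<lambda>p. L (fst p) (snd p))"
    and homogeneous: "\<And>z t. z \<in> U \<Longrightarrow> t > 0 \<Longrightarrow> L z (t *\<^sub>R y) = t * L z y"
  shows "euler_lagrange L x y \<bullet> y = 0"
proof -
  let ?D = "frechet_derivative (\<lambda>p. L (fst p) (snd p))"
  have L: "((\<lambda>p. L (fst p) (snd p)) has_derivative ?D (at (z, y))) (at (z, y))" if "z \<in> U" for z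
    using that assms by (intro smooth_on_has_derivative[OF smooth]) auto
  have L1: "((\<lambda>z. L z y) has_derivative (\<lambda>v. ?D (at (z, y)) (v, 0))) (at z)" if "z \<in> U" for z
    using has_derivative_fst_arg[OF L[OF that]] by simp
  have L2: "(L z has_derivative (\<lambda>v. ?D (at (z, y)) (0, v))) (at y)" if "z \<in> U" for z
    using has_derivative_snd_arg[OF L[OF that]] by simp
  have euler: "?D (at (z, y)) (0, y) = L z y" if z: "z \<in> U" for z
  proof -
    have "((\<lambda>t. L z (t *\<^sub>R y)) has_derivative (\<lambda>k. ?D (at (z, y)) (0, k *\<^sub>R y))) (at 1)"
    proof (rule has_derivative_compose[of "\<lambda>t. t *\<^sub>R y"])
      show "(L z has_derivative (\<lambda>v. ?D (at (z, y)) (0, v))) (at (1 *\<^sub>R y))"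
        using L2[OF z] by simp
    qed (auto intro!: derivative_eq_intros)
    moreover have "((\<lambda>t. L z (t *\<^sub>R y)) has_derivative (\<lambda>k. k * L z y)) (at 1)"
    proof (rule has_derivative_transform_within_open[of _ _ _ _ "{0<..}"])
      show "((\<lambda>t. t * L z y) has_derivative (\<lambda>k. k * L z y)) (at (1 :: real))"
        by (auto intro!: derivative_eq_intros)
    qed (use z homogeneous in auto)
    ultimately have "(\<lambda>k. ?D (at (z, y)) (0, k *\<^sub>R y)) = (\<lambda>k. k * L z y)"
      by (rule has_derivative_unique)
    from fun_cong[OF this, of 1] show ?thesis by simp
  qed
  define d where "d l = frechet_derivative (\<lambda>z. pd l (L z) y) (at x)" for l
  have d: "((\<lambda>z. pd l (L z) y) has_derivative d l) (at x)" for l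
    using differentiable_pd[OF assms(1-4)] by (simp add: d_def frechet_derivative_works)
  have "((\<lambda>z. \<Sum>l\<in>UNIV. pd l (L z) y * y $ l) has_derivative (\<lambda>v. \<Sum>l\<in>UNIV. d l v * y $ l)) (at x)"
    by (intro has_derivative_sum has_derivative_mult_left d)
  then have "((\<lambda>z. L z y) has_derivative (\<lambda>v. \<Sum>l\<in>UNIV. d l v * y $ l)) (at x)"
  proof (rule has_derivative_transform_within_open[OF _ \<open>open U\<close> \<open>x \<in> U\<close>])
    fix z assume z: "z \<in> U"
    have "(\<Sum>l\<in>UNIV. pd l (L z) y * y $ l) = frechet_derivative (L z) (at y) y"
      by (rule sum_pd[OF differentiableI[OF L2[OF z]]])
    also have "\<dots> = ?D (at (z, y)) (0, y)" by (simp add: frechet_derivative_at[OF L2[OF z], symmetric])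
    finally show "(\<Sum>l\<in>UNIV. pd l (L z) y * y $ l) = L z y" using euler[OF z] by simp
  qed
  from fun_cong[OF frechet_derivative_at[OF this], of y]
  have "(\<Sum>l\<in>UNIV. d l y * y $ l) = frechet_derivative (\<lambda>z. L z y) (at x) y" .
  also have "\<dots> = (\<Sum>l\<in>UNIV. pd l (\<lambda>z. L z y) x * y $ l)"
    by (rule sum_pd[OF differentiableI[OF L1[OF assms(2)]], symmetric])
  finally show ?thesis
    by (simp add: euler_lagrange_def inner_vec_def d_def left_diff_distrib sum_subtractf)
qed

text \<open>The product rule leaves an extra term along the fibre gradient of \<open>L\<close>. For
  a Finsler metric \<open>L\<close> this gradient is proportional to $g_{il} y^i$, so the extra term
  only changes the spray by a multiple of \<open>y\<close>.\<close>

lemma euler_lagrange_square: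
  assumes "open U" "x \<in> U" "y \<noteq> 0"
    and smooth: "smooth_on (U \<times> (- {0})) (\<lambda>p. L (fst p) (snd p))"
  shows "euler_lagrange (\<lambda>x y. (L x y)\<^sup>2) x y
    = (2 * L x y) *\<^sub>R euler_lagrange L x y
      + (2 * frechet_derivative (\<lambda>z. L z y) (at x) y) *\<^sub>R (\<chi> l. pd l (L x) y)"
proof -
  let ?D = "frechet_derivative (\<lambda>p. L (fst p) (snd p))"
  have L: "((\<lambda>p. L (fst p) (snd p)) has_derivative ?D (at (z, y))) (at (z, y))" if "z \<in> U" for z
    using that assms by (intro smooth_on_has_derivative[OF smooth]) auto
  have L1: "((\<lambda>z. L z y) has_derivative (\<lambda>v. ?D (at (z, y)) (v, 0))) (at z)" if "z \<in> U" for z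
    using has_derivative_fst_arg[OF L[OF that]] by simp
  have L2: "(L z has_derivative (\<lambda>v. ?D (at (z, y)) (0, v))) (at y)" if "z \<in> U" for z
    using has_derivative_snd_arg[OF L[OF that]] by simp
  define d where "d l = frechet_derivative (\<lambda>z. pd l (L z) y) (at x)" for l
  have d: "((\<lambda>z. pd l (L z) y) has_derivative d l) (at x)" for l
    using differentiable_pd[OF assms(1-4)] by (simp add: d_def frechet_derivative_works)
  define e where "e = frechet_derivative (\<lambda>z. L z y) (at x)"
  have e: "((\<lambda>z. L z y) has_derivative e) (at x)"
    unfolding e_def frechet_derivative_works[symmetric] by (rule differentiableI[OF L1[OF assms(2)]])
  have sq2: "pd l (\<lambda>w. (L z w)\<^sup>2) y = 2 * L z y * pd l (L z) y" if "z \<in> U" for z l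
    using has_derivative_power[OF L2[OF that], of 2]
    by (simp add: pd_has_derivative[OF L2[OF that]] pd_has_derivative)
  have sq1: "pd l (\<lambda>z. (L z y)\<^sup>2) x = 2 * L x y * pd l (\<lambda>z. L z y) x" for l
    using has_derivative_power[OF e, of 2]
    by (simp add: pd_has_derivative[OF e] pd_has_derivative)
  have "((\<lambda>z. 2 * (L z y * pd l (L z) y)) has_derivative
      (\<lambda>v. 2 * (L x y * d l v + e v * pd l (L x) y))) (at x)" for l
    by (intro has_derivative_mult_right has_derivative_mult e d)
  then have "((\<lambda>z. pd l (\<lambda>w. (L z w)\<^sup>2) y) has_derivative
      (\<lambda>v. 2 * (L x y * d l v + e v * pd l (L x) y))) (at x)" for l
    by (rule has_derivative_transform_within_open[OF _ \<open>open U\<close> \<open>x \<in> U\<close>]) (simp add: sq2)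
  then have "frechet_derivative (\<lambda>z. pd l (\<lambda>w. (L z w)\<^sup>2) y) (at x) v
      = 2 * (L x y * d l v + e v * pd l (L x) y)" for l v
    by (rule fun_cong[OF frechet_derivative_at[symmetric]])
  then show ?thesis
    by (simp add: euler_lagrange_def vec_eq_iff sq1 d_def e_def algebra_simps)
qed

section \<open>Hamel's criterion for Finsler metrics\<close>

context
  fixes U :: "(real^'n) set" and F :: "real^'n \<Rightarrow> real^'n \<Rightarrow> real"
  assumes open_U: "open U" and finsler: "finsler_metric_on U F"
    and pos: "\<And>x y. x \<in> U \<Longrightarrow> y \<noteq> 0 \<Longrightarrow> 0 < F x y"
begin

lemma finsler_smooth: "smooth_on (U \<times> (- {0})) (\<lambda>p. F (fst p) (snd p))"
  using finsler by (simp add: finsler_metric_on_def case_prod_beta')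

lemma finsler_homogeneous: "x \<in> U \<Longrightarrow> t > 0 \<Longrightarrow> F x (t *\<^sub>R y) = t * F x y"
  using finsler by (simp add: finsler_metric_on_def)

lemma finsler_smooth_sq: "smooth_on (U \<times> (- {0})) (\<lambda>p. (F (fst p) (snd p))\<^sup>2)"
  unfolding power2_eq_square using finsler_smooth open_U by (intro smooth_on_mult open_Times) auto

lemma finsler_homogeneous_sq: "x \<in> U \<Longrightarrow> t > 0 \<Longrightarrow> (F x (t *\<^sub>R y))\<^sup>2 = t\<^sup>2 * (F x y)\<^sup>2"
  by (simp add: finsler_homogeneous power_mult_distrib)

lemma invertible_fundamental_tensor:
  "x \<in> U \<Longrightarrow> y \<noteq> 0 \<Longrightarrow> invertible (fundamental_tensor F x y)"
  using finsler by (intro invertible_if_positive_definite) (simp add: finsler_metric_on_def)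

text \<open>As \<open>g *v y = F x y *\<^sub>R n\<close>, the line through \<open>y\<close>
  corresponds under \<open>g\<close> to the line through \<open>n\<close>. So the spray is parallel
  to \<open>y\<close> exactly if \<open>E\<close> is parallel to \<open>n\<close>, and then
  \<open>E\<close> vanishes because \<open>E \<bullet> y = 0\<close> while
  \<open>n \<bullet> y \<noteq> 0\<close>.\<close>

lemma spray_parallel_iff_euler_lagrange:
  assumes x: "x \<in> U" and y: "y \<noteq> 0"
  shows "(\<exists>k. spray F x y = k *\<^sub>R y) \<longleftrightarrow> euler_lagrange F x y = 0"
proof -
  define g where "g = fundamental_tensor F x y"
  define n where "n = (\<chi> l. pd l (F x) y)"
  define F0 where "F0 = frechet_derivative (\<lambda>z. F z y) (at x) y"
  define E where "E = euler_lagrange F x y"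
  have inv: "invertible g" unfolding g_def by (rule invertible_fundamental_tensor[OF x y])
  have diff: "(F x has_derivative (\<lambda>v. frechet_derivative (\<lambda>p. F (fst p) (snd p)) (at (x, y)) (0, v))) (at y)"
    using has_derivative_snd_arg[OF smooth_on_has_derivative[OF finsler_smooth], of x y] x y by simp
  have pdsq: "pd l (\<lambda>w. (F x w)\<^sup>2) y = 2 * F x y * n $ l" for l
    using has_derivative_power[OF diff, of 2]
    by (simp add: n_def pd_has_derivative[OF diff] pd_has_derivative)
  have gy: "g *v y = F x y *\<^sub>R n"
    using fundamental_tensor_mult_vector[OF open_U finsler_smooth_sq finsler_homogeneous_sq x y]
    by (simp add: g_def vec_eq_iff pdsq)
  have "4 *\<^sub>R spray F x y = matrix_inv g *v ((2 * F x y) *\<^sub>R E + (2 * F0) *\<^sub>R n)"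
    using spray_eq_euler_lagrange[OF open_U finsler_smooth_sq finsler_homogeneous_sq x y]
      euler_lagrange_square[OF open_U x y finsler_smooth]
    by (simp add: g_def E_def F0_def n_def)
  then have gs: "g *v (4 *\<^sub>R spray F x y) = (2 * F x y) *\<^sub>R E + (2 * F0) *\<^sub>R n"
    using matrix_inv_mult_vector(1)[OF inv] by simp
  have Fp: "0 < F x y" using pos[OF x y] .
  have "y \<bullet> (g *v y) > 0" using finsler x y by (simp add: finsler_metric_on_def g_def)
  then have ny: "n \<bullet> y \<noteq> 0" using gy by (auto simp: inner_commute)
  have Ey: "E \<bullet> y = 0"
    unfolding E_def by (rule euler_lagrange_contract[OF open_U x y finsler_smooth finsler_homogeneous])
  show ?thesis
  proof
    assume "\<exists>k. spray F x y = k *\<^sub>R y"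
    then obtain k where k: "spray F x y = k *\<^sub>R y" by blast
    have "g *v (4 *\<^sub>R spray F x y) = (4 * k) *\<^sub>R (g *v y)"
      by (simp add: k matrix_vector_mult_scaleR)
    also have "\<dots> = (4 * k * F x y) *\<^sub>R n" by (simp add: gy)
    finally have EQ: "(2 * F x y) *\<^sub>R E = (4 * k * F x y - 2 * F0) *\<^sub>R n"
      using gs by (simp add: algebra_simps)
    then have "(2 * F x y) *\<^sub>R E \<bullet> y = ((4 * k * F x y - 2 * F0) *\<^sub>R n) \<bullet> y" by simp
    then have c0: "4 * k * F x y - 2 * F0 = 0" using Ey ny by simp
    have "(2 * F x y) *\<^sub>R E = 0" unfolding EQ c0 by simp
    then show "euler_lagrange F x y = 0" using Fp unfolding E_def[symmetric] by simp
  next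
    assume "euler_lagrange F x y = 0"
    then have "g *v (4 *\<^sub>R spray F x y) = (2 * F0) *\<^sub>R n" using gs by (simp add: E_def)
    also have "\<dots> = g *v ((2 * F0 / F x y) *\<^sub>R y)"
      using Fp by (simp add: matrix_vector_mult_scaleR gy)
    finally have "matrix_inv g *v (g *v (4 *\<^sub>R spray F x y)) = matrix_inv g *v (g *v ((2 * F0 / F x y) *\<^sub>R y))"
      by simp
    then have "4 *\<^sub>R spray F x y = (2 * F0 / F x y) *\<^sub>R y"
      unfolding matrix_inv_mult_vector(2)[OF inv] .
    then have "(1/4) *\<^sub>R 4 *\<^sub>R spray F x y = (1/4) *\<^sub>R (2 * F0 / F x y) *\<^sub>R y" by simp
    then show "\<exists>k. spray F x y = k *\<^sub>R y" by auto
  qed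
qed

text \<open>The second order equation becomes a first order system \<open>H\<close> on the slit
  bundle. The solution stays in a ball inside that open set, which keeps the position in
  \<open>U\<close> and the velocity nonzero.\<close>

lemma geodesic_exists:
  assumes x: "x \<in> U" and y: "y \<noteq> 0"
  obtains e c c' where "0 < e" "c (0 :: real) = x" "c' 0 = y"
    "\<forall>t\<in>{-e<..<e}. c t \<in> U \<and> c' t \<noteq> 0 \<and> (c has_vector_derivative c' t) (at t) \<and>
        (c' has_vector_derivative - 2 *\<^sub>R spray F (c t) (c' t)) (at t)"
proof -
  let ?S = "U \<times> (- {0 :: real^'n})"
  define H where "H p = (snd p, - 2 *\<^sub>R spray F (fst p) (snd p))" for p :: "(real^'n) \<times> (real^'n)"
  have S: "open ?S" using open_U by (intro open_Times) auto
  \<comment> \<open>\<open>H\<close> is assembled from linear maps of \<open>p\<close> and of the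
    scalar components of the spray, for which smoothness is known.\<close>
  define A B where "A p = (snd p, 0 :: real^'n)" and "B i r = (0 :: real^'n, r *\<^sub>R (- 2 *\<^sub>R axis i (1::real)) :: real^'n)"
    for p :: "(real^'n) \<times> (real^'n)" and i r
  have "bounded_linear A"
    unfolding A_def by (rule bounded_linear_Pair[OF bounded_linear_snd bounded_linear_zero])
  then have sA: "k_smooth_on (Suc 0) ?S A" by (rule k_smooth_on_bounded_linear[OF S])
  have B: "bounded_linear (B i)" for i
    unfolding B_def by (rule bounded_linear_Pair[OF bounded_linear_zero bounded_linear_scaleR_left])
  have sB: "k_smooth_on (Suc 0) ?S (\<lambda>p. B i (spray F (fst p) (snd p) $ i))" for i
    by (rule k_smooth_on_bounded_linear_comp[OF S B k_smooth_on_spray[OF open_U finsler_smooth_sq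
            finsler_homogeneous_sq invertible_fundamental_tensor]])
  have "k_smooth_on (Suc 0) ?S (\<lambda>p. A p + (\<Sum>i\<in>UNIV. B i (spray F (fst p) (snd p) $ i)))"
    by (rule k_smooth_on_add[OF S sA k_smooth_on_sum[OF S sB]])
  moreover have "A p + (\<Sum>i\<in>UNIV. B i (spray F (fst p) (snd p) $ i)) = H p" for p
  proof -
    have "(\<Sum>i\<in>UNIV. v $ i *\<^sub>R - 2 *\<^sub>R axis i (1::real)) = - 2 *\<^sub>R v" for v :: "real^'n"
      using linear_sum_axis[OF linear_scale_self, of v "- 2"] by simp
    then show ?thesis by (simp add: prod_eq_iff A_def B_def H_def fst_sum snd_sum)
  qed
  ultimately have sH: "k_smooth_on (Suc 0) ?S H" by (simp only:)
  have xy: "(x, y) \<in> ?S" using x y by simp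
  obtain r L where r: "0 < r" "cball (x, y) r \<subseteq> ?S" "L-lipschitz_on (cball (x, y) r) H"
    by (rule k_smooth_on_locally_lipschitz[OF S xy sH])
  obtain e X where X: "0 < e" "X 0 = (x, y)"
    "\<forall>t\<in>{-e<..<e}. X t \<in> cball (x, y) r \<and> (X has_vector_derivative H (X t)) (at t)"
    by (rule picard_local_existence[OF r(1,3)])
  show ?thesis
  proof (rule that[of e "\<lambda>t. fst (X t)" "\<lambda>t. snd (X t)"])
    show "\<forall>t\<in>{-e<..<e}. fst (X t) \<in> U \<and> snd (X t) \<noteq> 0 \<and>
        ((\<lambda>t. fst (X t)) has_vector_derivative snd (X t)) (at t) \<and>
        ((\<lambda>t. snd (X t)) has_vector_derivative - 2 *\<^sub>R spray F (fst (X t)) (snd (X t))) (at t)"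
    proof
      fix t assume t: "t \<in> {-e<..<e}"
      have "X t \<in> ?S" using bspec[OF X(3) t] r(2) by blast
      moreover have "((\<lambda>t. fst (X t)) has_vector_derivative fst (H (X t))) (at t)"
        "((\<lambda>t. snd (X t)) has_vector_derivative snd (H (X t))) (at t)"
        by (rule bounded_linear.has_vector_derivative[OF bounded_linear_fst conjunct2[OF bspec[OF X(3) t]]],
          rule bounded_linear.has_vector_derivative[OF bounded_linear_snd conjunct2[OF bspec[OF X(3) t]]])
      ultimately show "fst (X t) \<in> U \<and> snd (X t) \<noteq> 0 \<and>
          ((\<lambda>t. fst (X t)) has_vector_derivative snd (X t)) (at t) \<and>
          ((\<lambda>t. snd (X t)) has_vector_derivative - 2 *\<^sub>R spray F (fst (X t)) (snd (X t))) (at t)"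
        by (auto simp: H_def mem_Times_iff)
    qed
  qed (use X in auto)
qed

theorem projectively_flat_iff_euler_lagrange:
  "projectively_flat_on U F \<longleftrightarrow> (\<forall>x\<in>U. \<forall>y. y \<noteq> 0 \<longrightarrow> euler_lagrange F x y = 0)"
proof (intro iffI ballI allI impI)
  fix x y :: "real^'n" assume flat: "projectively_flat_on U F" and x: "x \<in> U" and y: "y \<noteq> 0"
  obtain e c c' where e: "0 < e" "c (0 :: real) = x" "c' 0 = y" and c:
    "\<forall>t\<in>{-e<..<e}. c t \<in> U \<and> c' t \<noteq> 0 \<and> (c has_vector_derivative c' t) (at t) \<and>
        (c' has_vector_derivative - 2 *\<^sub>R spray F (c t) (c' t)) (at t)"
    by (rule geodesic_exists[OF x y])
  have "geodesic_on U F {-e<..<e} c"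
    unfolding geodesic_on_def
    by (intro conjI exI[of _ c'] open_greaterThanLessThan is_interval_oo c)
  then have col: "collinear (c ` {-e<..<e})" using flat projectively_flat_on_def by blast
  have 0: "(0::real) \<in> {-e<..<e}" using e by simp
  have "\<exists>k. - 2 *\<^sub>R spray F (c 0) (c' 0) = k *\<^sub>R c' 0"
  proof (rule acceleration_parallel_if_collinear_image[OF open_greaterThanLessThan 0 col])
    show "(c has_vector_derivative c' s) (at s)" if "s \<in> {-e<..<e}" for s
      using bspec[OF c that] by simp
    show "(c' has_vector_derivative - 2 *\<^sub>R spray F (c 0) (c' 0)) (at 0)" "c' 0 \<noteq> 0"
      using bspec[OF c 0] by simp_all
  qed
  then obtain k where "- 2 *\<^sub>R spray F (c 0) (c' 0) = k *\<^sub>R c' 0" by blast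
  then have "(- 1/2) *\<^sub>R - 2 *\<^sub>R spray F x y = (- 1/2) *\<^sub>R k *\<^sub>R y" using e by simp
  then have "spray F x y = (- k / 2) *\<^sub>R y" by simp
  then show "euler_lagrange F x y = 0" using spray_parallel_iff_euler_lagrange[OF x y] by blast
next
  assume EL: "\<forall>x\<in>U. \<forall>y. y \<noteq> 0 \<longrightarrow> euler_lagrange F x y = 0"
  then have "\<exists>k. spray F x y = k *\<^sub>R y" if "x \<in> U" "y \<noteq> 0" for x y
    using spray_parallel_iff_euler_lagrange that by blast
  then obtain k where k: "\<And>x y. x \<in> U \<Longrightarrow> y \<noteq> 0 \<Longrightarrow> spray F x y = k x y *\<^sub>R y" by metis
  show "projectively_flat_on U F"
    unfolding projectively_flat_on_def
  proof (intro allI impI)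
    fix I c assume "geodesic_on U F I c"
    then obtain c' where I: "open I" "is_interval I" and c: "\<And>t. t \<in> I \<Longrightarrow> c t \<in> U \<and> c' t \<noteq> 0 \<and>
        (c has_vector_derivative c' t) (at t) \<and>
        (c' has_vector_derivative - 2 *\<^sub>R spray F (c t) (c' t)) (at t)"
      unfolding geodesic_on_def by blast
    show "collinear (c ` I)"
    proof (rule collinear_image_if_acceleration_parallel[OF I, of c c' "\<lambda>t. - 2 * k (c t) (c' t)"])
      show "(c' has_vector_derivative (- 2 * k (c t) (c' t)) *\<^sub>R c' t) (at t)" if "t \<in> I" for t
        using c[OF that] k[of "c t" "c' t"] by simp
      show "(c has_vector_derivative c' t) (at t)" "c' t \<noteq> 0" if "t \<in> I" for t
        using c[OF that] by simp_all
    qed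
  qed
qed

end

section \<open>Riemannian metrics\<close>

lemma k_smooth_on_fst:
  assumes "open U" "open V"
  shows "k_smooth_on k U f \<Longrightarrow> k_smooth_on k (U \<times> V) (\<lambda>p. f (fst p))"
proof (induction k arbitrary: f)
  case 0
  then show ?case by (auto intro!: continuous_on_compose2[of U f] continuous_intros)
next
  case (Suc k)
  show ?case
  proof (rule k_smooth_on_SucI)
    show "open (U \<times> V)" using assms by (rule open_Times)
    show "((\<lambda>p. f (fst p)) has_derivative (\<lambda>v. frechet_derivative f (at (fst p)) (fst v))) (at p)"
      if "p \<in> U \<times> V" for p
      using that by (intro has_derivative_compose[OF _ k_smooth_on_has_derivative[OF Suc.prems]]
          bounded_linear_imp_has_derivative bounded_linear_fst) auto
    show "k_smooth_on k (U \<times> V) (\<lambda>p. frechet_derivative f (at (fst p)) (fst v))" for v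
      using Suc.prems by (intro Suc.IH) simp
  qed
qed

lemma has_derivative_quotient:
  fixes A G :: "'a::real_normed_vector \<Rightarrow> real"
  assumes "(G has_derivative G') (at e)" "(A has_derivative A') (at e)" "A e \<noteq> 0"
  shows "((\<lambda>e. G e / A e) has_derivative (\<lambda>v. (G' v - G e / A e * A' v) / A e)) (at e)"
  using has_derivative_divide'[OF assms] assms(3) by (simp add: field_simps)

lemma has_derivative_at_pair_args:
  fixes f :: "real \<times> real \<Rightarrow> real" and A B C :: "'a::real_normed_vector \<Rightarrow> real"
  assumes A: "(A has_derivative A') (at e)" and B: "(B has_derivative B') (at e)"
    and C: "(C has_derivative C') (at e)" and nz: "A e \<noteq> 0"
    and f: "f differentiable (at (B e / A e, C e / A e))"
  shows "((\<lambda>e. f (B e / A e, C e / A e)) has_derivative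
    (\<lambda>v. (d1 f (B e / A e, C e / A e) * (B' v - B e / A e * A' v)
        + d2 f (B e / A e, C e / A e) * (C' v - C e / A e * A' v)) / A e)) (at e)"
proof -
  let ?p = "(B e / A e, C e / A e)"
  let ?D = "frechet_derivative f (at ?p)"
  have D: "(f has_derivative ?D) (at ?p)" using f by (simp add: frechet_derivative_works)
  have lin: "?D (h, k) = h * d1 f ?p + k * d2 f ?p" for h k
  proof -
    have "?D (h, k) = ?D (h *\<^sub>R (1, 0) + k *\<^sub>R (0, 1))" by simp
    also have "\<dots> = h * d1 f ?p + k * d2 f ?p"
      using has_derivative_linear[OF D] unfolding d1_def d2_def
      by (simp only: linear_add linear_scale real_scaleR_def)
    finally show ?thesis .
  qed
  note quot = has_derivative_quotient[OF _ A nz]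
  have "((\<lambda>e. f (B e / A e, C e / A e)) has_derivative
     (\<lambda>v. ?D ((B' v - B e / A e * A' v) / A e, (C' v - C e / A e * A' v) / A e))) (at e)"
    by (rule has_derivative_compose[OF has_derivative_Pair[OF quot[OF B] quot[OF C]] D])
  then show ?thesis by (simp add: lin add_divide_distrib mult.commute)
qed

text \<open>\<open>A\<close>, \<open>B\<close>, \<open>C\<close> stand for \<alpha>, \<beta>,
  \<gamma>, as functions either of the base point or of the tangent vector. The coefficient of
  \<open>A'\<close> is the origin of \<Pi>.\<close>

lemma has_derivative_homogeneous_pair:
  fixes f :: "real \<times> real \<Rightarrow> real" and A B C :: "'a::real_normed_vector \<Rightarrow> real"
  assumes A: "(A has_derivative A') (at e)" and B: "(B has_derivative B') (at e)"
    and C: "(C has_derivative C') (at e)" and nz: "A e \<noteq> 0"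
    and f: "f differentiable (at (B e / A e, C e / A e))"
  defines "p \<equiv> (B e / A e, C e / A e)"
  shows "((\<lambda>e. A e * f (B e / A e, C e / A e)) has_derivative
    (\<lambda>v. (f p - B e / A e * d1 f p - C e / A e * d2 f p) * A' v + d1 f p * B' v + d2 f p * C' v)) (at e)"
proof -
  have "((\<lambda>e. A e * f (B e / A e, C e / A e)) has_derivative
    (\<lambda>v. A e * ((d1 f p * (B' v - B e / A e * A' v) + d2 f p * (C' v - C e / A e * A' v)) / A e) + A' v * f p)) (at e)"
    unfolding p_def by (intro has_derivative_mult A has_derivative_at_pair_args[OF assms(1-5)])
  then show ?thesis
    by (rule has_derivative_eq_rhs) (use nz in \<open>simp add: fun_eq_iff field_simps\<close>)
qed

lemma symmetric_inner_mult:
  fixes A :: "real^'n^'n"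
  assumes "transpose A = A"
  shows "v \<bullet> (A *v w) = w \<bullet> (A *v v)"
proof -
  have "v \<bullet> (A *v w) = (v v* A) \<bullet> w" by (simp add: dot_lmul_matrix)
  also have "v v* A = A *v v" using transpose_matrix_vector[of A v] by (simp only: assms)
  finally show ?thesis by (simp add: inner_commute)
qed

lemma matrix_vector_mult_bounded_linear_left: "bounded_linear (\<lambda>A :: real^'n^'m. A *v y)"
  by (rule linear_conv_bounded_linear[THEN iffD1], rule linearI)
    (simp_all only: matrix_vector_mult_add_rdistrib scaleR_matrix_vector_assoc)

lemma has_derivative_mult_vector:
  fixes a :: "'a::real_normed_vector \<Rightarrow> real^'n^'m"
  assumes "(a has_derivative a') (at x)"
  shows "((\<lambda>z. a z *v y) has_derivative (\<lambda>v. a' v *v y)) (at x)"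
  by (rule bounded_linear.has_derivative[OF matrix_vector_mult_bounded_linear_left assms])

lemma has_derivative_sqrt_comp:
  fixes g :: "'a::real_normed_vector \<Rightarrow> real"
  assumes "(g has_derivative g') (at x)" "0 < g x"
  shows "((\<lambda>x. sqrt (g x)) has_derivative (\<lambda>v. g' v / (2 * sqrt (g x)))) (at x)"
proof -
  have "(sqrt has_derivative (*) (inverse (sqrt (g x)) / 2)) (at (g x))"
    using DERIV_real_sqrt[OF assms(2)] by (simp only: has_field_derivative_def)
  from has_derivative_compose[OF assms(1) this]
  have "((\<lambda>x. sqrt (g x)) has_derivative (\<lambda>v. inverse (sqrt (g x)) / 2 * g' v)) (at x)" .
  moreover have "inverse (sqrt (g x)) / 2 * g' v = g' v / (2 * sqrt (g x))" for v
    by (simp add: field_simps)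
  ultimately show ?thesis by (simp only:)
qed

lemma inner_sum_axis:
  fixes f :: "real^'n \<Rightarrow> 'b::real_inner"
  shows "linear f \<Longrightarrow> (\<Sum>k\<in>UNIV. v $ k * (f (axis k 1) \<bullet> w)) = f v \<bullet> w"
  using arg_cong[OF linear_sum_axis[of f v], of "\<lambda>u. u \<bullet> w"] by (simp add: inner_sum_left)

locale riemannian =
  fixes U :: "(real^'n) set" and a :: "real^'n \<Rightarrow> real^'n^'n"
  assumes open_U: "open U" and riem: "riemannian_metric_on U a"
begin

lemma a_sym: "x \<in> U \<Longrightarrow> transpose (a x) = a x"
  using riem by (simp add: riemannian_metric_on_def)

lemma a_sym_nth: "x \<in> U \<Longrightarrow> a x $ i $ j = a x $ j $ i"
  using arg_cong[OF a_sym[of x], of "\<lambda>A. A $ j $ i"] by (simp add: transpose_def)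

lemma a_pos: "x \<in> U \<Longrightarrow> v \<noteq> 0 \<Longrightarrow> 0 < v \<bullet> (a x *v v)"
  using riem by (simp add: riemannian_metric_on_def)

lemma a_inner_commute: "x \<in> U \<Longrightarrow> v \<bullet> (a x *v w) = w \<bullet> (a x *v v)"
  by (rule symmetric_inner_mult[OF a_sym])

lemma a_invertible: "x \<in> U \<Longrightarrow> invertible (a x)"
  by (rule invertible_if_positive_definite[OF a_pos])

lemma raise_mult: "x \<in> U \<Longrightarrow> a x *v raise a x v = v"
  by (simp add: raise_def matrix_inv_mult_vector[OF a_invertible])

lemma raise_inner: "x \<in> U \<Longrightarrow> raise a x v \<bullet> (a x *v w) = v \<bullet> w"
  using a_inner_commute[of x "raise a x v" w] by (simp add: raise_mult inner_commute)

lemma raise_inner_commute: "x \<in> U \<Longrightarrow> v \<bullet> raise a x w = raise a x v \<bullet> w"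
  using raise_inner[of x v "raise a x w"] by (simp add: raise_mult)

lemma riem_norm_sq: "x \<in> U \<Longrightarrow> (riem_norm a x y)\<^sup>2 = y \<bullet> (a x *v y)"
  using a_pos[of x y] by (cases "y = 0") (simp_all add: riem_norm_def)

lemma riem_norm_pos: "x \<in> U \<Longrightarrow> y \<noteq> 0 \<Longrightarrow> 0 < riem_norm a x y"
  using a_pos by (simp add: riem_norm_def)

lemma riem_norm_deriv_snd:
  assumes "x \<in> U" "y \<noteq> 0"
  shows "(riem_norm a x has_derivative (\<lambda>v. (v \<bullet> (a x *v y)) / riem_norm a x y)) (at y)"
proof -
  have "((\<lambda>y. y \<bullet> (a x *v y)) has_derivative (\<lambda>v. y \<bullet> (a x *v v) + v \<bullet> (a x *v y))) (at y)"
    by (rule has_derivative_inner[OF has_derivative_ident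
          bounded_linear_imp_has_derivative[OF matrix_vector_mul_bounded_linear]])
  then have "((\<lambda>y. sqrt (y \<bullet> (a x *v y))) has_derivative
      (\<lambda>v. (y \<bullet> (a x *v v) + v \<bullet> (a x *v y)) / (2 * sqrt (y \<bullet> (a x *v y))))) (at y)"
    by (rule has_derivative_sqrt_comp) (rule a_pos[OF assms])
  moreover have "riem_norm a x = (\<lambda>y. sqrt (y \<bullet> (a x *v y)))"
    by (rule ext) (simp only: riem_norm_def)
  moreover have "(y \<bullet> (a x *v v) + v \<bullet> (a x *v y)) / (2 * r) = v \<bullet> (a x *v y) / r" for v r
    using a_inner_commute[OF assms(1), of y v] by simp
  ultimately show ?thesis by (simp only:)
qed

lemma riem_norm_deriv_fst:
  assumes "x \<in> U" "y \<noteq> 0" "(a has_derivative a') (at x)"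
  shows "((\<lambda>z. riem_norm a z y) has_derivative (\<lambda>v. (y \<bullet> (a' v *v y)) / (2 * riem_norm a x y))) (at x)"
  unfolding riem_norm_def
proof (rule has_derivative_sqrt_comp)
  show "((\<lambda>z. y \<bullet> (a z *v y)) has_derivative (\<lambda>v. y \<bullet> (a' v *v y))) (at x)"
    by (rule has_derivative_inner_right[OF has_derivative_mult_vector[OF assms(3)]])
  show "0 < y \<bullet> (a x *v y)" by (rule a_pos[OF assms(1,2)])
qed

lemma pd_riem_norm_snd:
  "x \<in> U \<Longrightarrow> y \<noteq> 0 \<Longrightarrow> pd l (riem_norm a x) y = (a x *v y) $ l / riem_norm a x y"
  by (simp add: pd_has_derivative[OF riem_norm_deriv_snd] inner_axis')

lemma alpha_low_eq:
  "x \<in> U \<Longrightarrow> y \<noteq> 0 \<Longrightarrow> alpha_low a x y = (1 / riem_norm a x y) *\<^sub>R (a x *v y)"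
  by (simp add: alpha_low_def vec_eq_iff pd_riem_norm_snd)

lemma pd_riem_norm_sq_snd:
  assumes "x \<in> U"
  shows "pd i (\<lambda>v. (riem_norm a x v)\<^sup>2) y = 2 * (a x *v y) $ i"
proof -
  have "((\<lambda>y. y \<bullet> (a x *v y)) has_derivative (\<lambda>v. y \<bullet> (a x *v v) + v \<bullet> (a x *v y))) (at y)"
    by (rule has_derivative_inner[OF has_derivative_ident
          bounded_linear_imp_has_derivative[OF matrix_vector_mul_bounded_linear]])
  then show ?thesis
    using a_inner_commute[OF assms, of y "axis i 1"]
    by (simp add: riem_norm_sq[OF assms] pd_has_derivative inner_axis')
qed

lemma fundamental_tensor_riem_norm:
  assumes "x \<in> U"
  shows "fundamental_tensor (riem_norm a) x y = a x"
proof -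
  have "((\<lambda>w. 2 * (a x *v w) $ i) has_derivative (\<lambda>v. 2 * (a x *v v) $ i)) (at y)" for i
    by (rule has_derivative_mult_right[OF bounded_linear_imp_has_derivative[OF
          bounded_linear_compose[OF bounded_linear_vec_nth matrix_vector_mul_bounded_linear]]])
  then have "pd j (\<lambda>w. 2 * (a x *v w) $ i) y = 2 * (a x *v axis j 1) $ i" for i j
    by (rule pd_has_derivative)
  then show ?thesis
    by (simp add: fundamental_tensor_def vec_eq_iff pd_riem_norm_sq_snd[OF assms]
        matrix_vector_mult_basis column_def)
qed

lemma smooth_riem_norm_sq: "smooth_on (U \<times> (- {0})) (\<lambda>p. (riem_norm a (fst p) (snd p))\<^sup>2)"
  unfolding smooth_on_def
proof
  fix k
  let ?S = "U \<times> (- {0 :: real^'n})"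
  have S: "open ?S" "open (- {0 :: real^'n})" using open_U by (auto intro: open_Times)
  have "k_smooth_on k U a" using riem by (simp add: riemannian_metric_on_def smooth_on_def)
  then have "k_smooth_on k ?S (\<lambda>p. a (fst p) $ i $ j)" for i j
    by (rule k_smooth_on_bounded_linear_comp[OF S(1) bounded_linear_compose[OF bounded_linear_vec_nth bounded_linear_vec_nth]
          k_smooth_on_fst[OF open_U S(2)]])
  moreover have "k_smooth_on k ?S (\<lambda>p. snd p $ j)" for j
    by (rule k_smooth_on_bounded_linear[OF S(1) bounded_linear_compose[OF bounded_linear_vec_nth bounded_linear_snd]])
  ultimately have "k_smooth_on k ?S (\<lambda>p. \<Sum>i\<in>UNIV. snd p $ i * (\<Sum>j\<in>UNIV. a (fst p) $ i $ j * snd p $ j))"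
    by (intro k_smooth_on_sum k_smooth_on_mult S)
  then show "k_smooth_on k ?S (\<lambda>p. (riem_norm a (fst p) (snd p))\<^sup>2)"
    by (rule k_smooth_on_cong[OF S(1), rotated])
      (auto simp: riem_norm_sq inner_vec_def matrix_vector_mult_def)
qed

lemma riem_norm_homogeneous_sq:
  "x \<in> U \<Longrightarrow> t > 0 \<Longrightarrow> (riem_norm a x (t *\<^sub>R y))\<^sup>2 = t\<^sup>2 * (riem_norm a x y)\<^sup>2"
  unfolding riem_norm_sq by (simp add: matrix_vector_mult_scaleR power2_eq_square)

lemma euler_lagrange_riem_norm_sq:
  assumes "x \<in> U" "(a has_derivative a') (at x)"
  shows "euler_lagrange (\<lambda>x y. (riem_norm a x y)\<^sup>2) x y
    = (\<chi> l. 2 * (a' y *v y) $ l - y \<bullet> (a' (axis l 1) *v y))"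
proof -
  have 1: "((\<lambda>z. pd l (\<lambda>v. (riem_norm a z v)\<^sup>2) y) has_derivative (\<lambda>v. 2 * (a' v *v y) $ l)) (at x)" for l
  proof (rule has_derivative_transform_within_open[OF _ open_U assms(1)])
    show "((\<lambda>z. 2 * (a z *v y) $ l) has_derivative (\<lambda>v. 2 * (a' v *v y) $ l)) (at x)"
      by (rule has_derivative_mult_right[OF bounded_linear.has_derivative[OF bounded_linear_vec_nth
            has_derivative_mult_vector[OF assms(2)]]])
  qed (simp add: pd_riem_norm_sq_snd)
  have 2: "((\<lambda>z. (riem_norm a z y)\<^sup>2) has_derivative (\<lambda>v. y \<bullet> (a' v *v y))) (at x)"
  proof (rule has_derivative_transform_within_open[OF _ open_U assms(1)])
    show "((\<lambda>z. y \<bullet> (a z *v y)) has_derivative (\<lambda>v. y \<bullet> (a' v *v y))) (at x)"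
      by (rule has_derivative_inner_right[OF has_derivative_mult_vector[OF assms(2)]])
  qed (simp add: riem_norm_sq)
  show ?thesis
    unfolding euler_lagrange_def pd_has_derivative[OF 2] frechet_derivative_at[OF 1, symmetric] ..
qed

lemma spray_riem_norm:
  assumes "x \<in> U" "y \<noteq> 0" "(a has_derivative a') (at x)"
  shows "4 *\<^sub>R (a x *v spray (riem_norm a) x y) = (\<chi> l. 2 * (a' y *v y) $ l - y \<bullet> (a' (axis l 1) *v y))"
proof -
  have "4 *\<^sub>R spray (riem_norm a) x y = matrix_inv (a x) *v euler_lagrange (\<lambda>x y. (riem_norm a x y)\<^sup>2) x y"
    using spray_eq_euler_lagrange[OF open_U smooth_riem_norm_sq riem_norm_homogeneous_sq assms(1,2)]
    by (simp add: fundamental_tensor_riem_norm[OF assms(1)])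
  then have "a x *v (4 *\<^sub>R spray (riem_norm a) x y) = euler_lagrange (\<lambda>x y. (riem_norm a x y)\<^sup>2) x y"
    using matrix_inv_mult_vector(1)[OF a_invertible[OF assms(1)]] by simp
  then show ?thesis
    by (simp add: euler_lagrange_riem_norm_sq[OF assms(1,3)] matrix_vector_mult_scaleR)
qed

lemma spray_riem_norm_inner:
  assumes "x \<in> U" "y \<noteq> 0" "(a has_derivative a') (at x)"
  shows "y \<bullet> (a' y *v y) = 4 * riem_norm a x y * (alpha_low a x y \<bullet> spray (riem_norm a) x y)"
proof -
  have lin: "linear (\<lambda>v. a' v *v y)"
    by (rule has_derivative_linear[OF has_derivative_mult_vector[OF assms(3)]])
  have "(4 *\<^sub>R (a x *v spray (riem_norm a) x y)) \<bullet> y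
      = (\<Sum>l\<in>UNIV. 2 * ((a' y *v y) $ l * y $ l) - y $ l * ((a' (axis l 1) *v y) \<bullet> y))"
    unfolding spray_riem_norm[OF assms] inner_vec_def[of "vec_lambda _"]
    by (simp add: algebra_simps inner_commute)
  also have "\<dots> = 2 * ((a' y *v y) \<bullet> y) - (a' y *v y) \<bullet> y"
    using inner_sum_axis[OF lin, of y y]
    by (simp add: sum_subtractf sum_distrib_left[symmetric] inner_vec_def[of "a' y *v y" y])
  finally have "y \<bullet> (a' y *v y) = 4 * (y \<bullet> (a x *v spray (riem_norm a) x y))"
    by (simp add: inner_commute)
  then show ?thesis
    using riem_norm_pos[OF assms(1,2)] a_inner_commute[OF assms(1), of y "spray (riem_norm a) x y"]
    by (simp add: alpha_low_eq[OF assms(1,2)] inner_commute)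
qed

lemma alpha_h_mult:
  "alpha_h a x y *v v = a x *v v - (alpha_low a x y \<bullet> v) *\<^sub>R alpha_low a x y"
  by (simp add: alpha_h_def vec_eq_iff matrix_vector_mult_def inner_vec_def sum_subtractf
      sum_distrib_left algebra_simps)

lemma alpha_low_deriv_fst:
  assumes "x \<in> U" "y \<noteq> 0" "(a has_derivative a') (at x)"
  shows "((\<lambda>z. alpha_low a z y $ l) has_derivative
    (\<lambda>v. ((a' v *v y) $ l - alpha_low a x y $ l * (y \<bullet> (a' v *v y) / (2 * riem_norm a x y))) / riem_norm a x y)) (at x)"
proof (rule has_derivative_transform_within_open[OF _ open_U assms(1)])
  have nz: "riem_norm a x y \<noteq> 0" using riem_norm_pos[OF assms(1,2)] by simp
  have "((\<lambda>z. (a z *v y) $ l) has_derivative (\<lambda>v. (a' v *v y) $ l)) (at x)"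
    by (rule bounded_linear.has_derivative[OF bounded_linear_vec_nth has_derivative_mult_vector[OF assms(3)]])
  from has_derivative_divide'[OF this riem_norm_deriv_fst[OF assms] nz]
  show "((\<lambda>z. (a z *v y) $ l / riem_norm a z y) has_derivative
    (\<lambda>v. ((a' v *v y) $ l - alpha_low a x y $ l * (y \<bullet> (a' v *v y) / (2 * riem_norm a x y))) / riem_norm a x y)) (at x)"
    by (rule has_derivative_eq_rhs)
      (use nz in \<open>simp add: fun_eq_iff alpha_low_eq[OF assms(1,2)] field_simps\<close>)
qed (use assms in \<open>simp add: alpha_low_eq\<close>)

lemma euler_lagrange_riem_norm:
  assumes "x \<in> U" "y \<noteq> 0" "(a has_derivative a') (at x)"
  shows "((a' y *v y) $ l - alpha_low a x y $ l * (y \<bullet> (a' y *v y) / (2 * riem_norm a x y))) / riem_norm a x y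
      - (y \<bullet> (a' (axis l 1) *v y)) / (2 * riem_norm a x y)
    = 2 / riem_norm a x y * (alpha_h a x y *v spray (riem_norm a) x y) $ l"
proof -
  let ?G = "spray (riem_norm a) x y" and ?\<alpha> = "riem_norm a x y"
  have \<alpha>: "?\<alpha> \<noteq> 0" using riem_norm_pos[OF assms(1,2)] by simp
  have aG: "4 * (a x *v ?G) $ l = 2 * (a' y *v y) $ l - y \<bullet> (a' (axis l 1) *v y)"
    using spray_riem_norm[OF assms] by (simp add: vec_eq_iff)
  have "((a' y *v y) $ l - alpha_low a x y $ l * (y \<bullet> (a' y *v y) / (2 * ?\<alpha>))) / ?\<alpha>
      - (y \<bullet> (a' (axis l 1) *v y)) / (2 * ?\<alpha>)
    = (2 * (a' y *v y) $ l - y \<bullet> (a' (axis l 1) *v y)) / (2 * ?\<alpha>)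
      - alpha_low a x y $ l * (y \<bullet> (a' y *v y)) / (2 * ?\<alpha>\<^sup>2)"
    using \<alpha> by (simp add: field_simps power2_eq_square)
  also have "\<dots> = 2 / ?\<alpha> * ((a x *v ?G) $ l - (alpha_low a x y \<bullet> ?G) * alpha_low a x y $ l)"
    unfolding aG[symmetric] spray_riem_norm_inner[OF assms] using \<alpha>
    by (simp add: field_simps power2_eq_square)
  finally show ?thesis by (simp add: alpha_h_mult)
qed

section \<open>Covariant derivatives of 1-forms in terms of the spray\<close>

lemma pd_a:
  assumes "(a has_derivative a') (at x)"
  shows "pd k (\<lambda>z. a z $ i $ j) x = a' (axis k 1) $ i $ j"
  by (rule pd_has_derivative[OF bounded_linear.has_derivative[OF
        bounded_linear_compose[OF bounded_linear_vec_nth bounded_linear_vec_nth] assms]])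

lemma a'_sym:
  assumes "x \<in> U" "(a has_derivative a') (at x)"
  shows "a' v $ i $ j = a' v $ j $ i"
proof -
  have *: "((\<lambda>z. a z $ i $ j) has_derivative (\<lambda>v. a' v $ i $ j)) (at x)" for i j
    by (rule bounded_linear.has_derivative[OF
          bounded_linear_compose[OF bounded_linear_vec_nth bounded_linear_vec_nth] assms(2)])
  have "((\<lambda>z. a z $ i $ j) has_derivative (\<lambda>v. a' v $ j $ i)) (at x)"
    by (rule has_derivative_transform_within_open[OF * open_U assms(1)]) (rule a_sym_nth)
  from has_derivative_unique[OF * this] show ?thesis by (rule fun_cong)
qed

lemma christoffel_sym:
  assumes "x \<in> U" "(a has_derivative a') (at x)"
  shows "christoffel a x k i j = christoffel a x k j i"
  unfolding christoffel_def pd_a[OF assms(2)] a'_sym[OF assms, of _ i j] by (simp add: add.commute)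

text \<open>Both sides contract the same bracket of first derivatives of \<open>a\<close>; the
  factor 2 is the ratio of the normalisations 1/2 and 1/4.\<close>

lemma christoffel_contract:
  assumes "x \<in> U" "y \<noteq> 0" "(a has_derivative a') (at x)"
  shows "(\<Sum>i\<in>UNIV. \<Sum>j\<in>UNIV. christoffel a x k i j * y $ i * y $ j) = 2 * spray (riem_norm a) x y $ k"
proof -
  have lin: "linear (\<lambda>v. a' v *v y)"
    by (rule has_derivative_linear[OF has_derivative_mult_vector[OF assms(3)]])
  have lin': "(\<Sum>i\<in>UNIV. y $ i * (a' (axis i 1) *v y) $ l) = (a' y *v y) $ l" for l
    using arg_cong[OF linear_sum_axis[OF lin, of y], of "\<lambda>v. v $ l"] by simp
  have "(\<Sum>i\<in>UNIV. \<Sum>j\<in>UNIV. a' (axis i 1) $ j $ l * y $ i * y $ j)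
      = (\<Sum>i\<in>UNIV. y $ i * (a' (axis i 1) *v y) $ l)" for l
    by (simp add: matrix_vector_mult_def sum_distrib_left mult_ac a'_sym[OF assms(1,3), of _ _ l])
  then have 1: "(\<Sum>i\<in>UNIV. \<Sum>j\<in>UNIV. a' (axis i 1) $ j $ l * y $ i * y $ j) = (a' y *v y) $ l" for l
    unfolding lin' .
  have 2: "(\<Sum>i\<in>UNIV. \<Sum>j\<in>UNIV. a' (axis j 1) $ i $ l * y $ i * y $ j) = (a' y *v y) $ l" for l
    by (subst sum.swap) (simp add: 1[symmetric] mult_ac)
  have 3: "(\<Sum>i\<in>UNIV. \<Sum>j\<in>UNIV. a' (axis l 1) $ i $ j * y $ i * y $ j) = y \<bullet> (a' (axis l 1) *v y)" for l
    by (simp add: inner_vec_def matrix_vector_mult_def sum_distrib_left mult_ac)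
  have "(\<Sum>i\<in>UNIV. \<Sum>j\<in>UNIV. christoffel a x k i j * y $ i * y $ j)
    = (\<Sum>i\<in>UNIV. \<Sum>j\<in>UNIV. \<Sum>l\<in>UNIV. 1/2 * matrix_inv (a x) $ k $ l *
        ((a' (axis i 1) $ j $ l + a' (axis j 1) $ i $ l - a' (axis l 1) $ i $ j) * y $ i * y $ j))"
    unfolding christoffel_def pd_a[OF assms(3)] by (simp add: sum_distrib_left sum_distrib_right mult_ac)
  also have "\<dots> = (\<Sum>l\<in>UNIV. \<Sum>i\<in>UNIV. \<Sum>j\<in>UNIV. 1/2 * matrix_inv (a x) $ k $ l *
        ((a' (axis i 1) $ j $ l + a' (axis j 1) $ i $ l - a' (axis l 1) $ i $ j) * y $ i * y $ j))"
    by (subst sum.swap[of _ UNIV UNIV], subst (2) sum.swap) (rule refl)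
  also have "\<dots> = (\<Sum>l\<in>UNIV. 1/2 * matrix_inv (a x) $ k $ l * (2 * (a' y *v y) $ l - y \<bullet> (a' (axis l 1) *v y)))"
    unfolding sum_distrib_left[symmetric] left_diff_distrib distrib_right sum.distrib sum_subtractf 1 2 3
    by simp
  also have "\<dots> = 1/2 * (matrix_inv (a x) *v (4 *\<^sub>R (a x *v spray (riem_norm a) x y))) $ k"
    unfolding spray_riem_norm[OF assms] by (simp add: matrix_vector_mult_def sum_distrib_left mult_ac)
  also have "\<dots> = 2 * spray (riem_norm a) x y $ k"
    by (simp add: matrix_vector_mult_scaleR matrix_inv_mult_vector[OF a_invertible[OF assms(1)]])
  finally show ?thesis .
qed

lemma pd_nth:
  fixes b :: "real^'n \<Rightarrow> real^'n"
  assumes "(b has_derivative b') (at x)"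
  shows "pd k (\<lambda>z. b z $ i) x = b' (axis k 1) $ i"
  by (rule pd_has_derivative[OF bounded_linear.has_derivative[OF bounded_linear_vec_nth assms]])

text \<open>Contracting twice with \<open>y\<close> makes the symmetrisation invisible, and the
  Christoffel part becomes a multiple of the spray by \<open>christoffel_contract\<close>.\<close>

lemma r_00_eq:
  assumes "x \<in> U" "y \<noteq> 0" "(a has_derivative a') (at x)" "(b has_derivative b') (at x)"
  shows "r_00 a b x y = b' y \<bullet> y - 2 * (b x \<bullet> spray (riem_norm a) x y)"
proof -
  let ?c = "cov_deriv a b x"
  have swap: "(\<Sum>i\<in>UNIV. \<Sum>j\<in>UNIV. ?c $ j $ i * y $ i * y $ j) = (\<Sum>i\<in>UNIV. \<Sum>j\<in>UNIV. ?c $ i $ j * y $ i * y $ j)"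
    by (subst sum.swap) (simp add: mult_ac)
  have "r_00 a b x y = 1/2 * (\<Sum>i\<in>UNIV. \<Sum>j\<in>UNIV. ?c $ i $ j * y $ i * y $ j)
      + 1/2 * (\<Sum>i\<in>UNIV. \<Sum>j\<in>UNIV. ?c $ j $ i * y $ i * y $ j)"
    by (simp add: r_00_def r_tensor_def sum_distrib_left sum.distrib[symmetric] field_simps)
  also have "\<dots> = (\<Sum>i\<in>UNIV. \<Sum>j\<in>UNIV. ?c $ i $ j * y $ i * y $ j)" unfolding swap by simp
  also have "\<dots> = (\<Sum>i\<in>UNIV. \<Sum>j\<in>UNIV. b' (axis j 1) $ i * y $ i * y $ j)
      - (\<Sum>i\<in>UNIV. \<Sum>j\<in>UNIV. \<Sum>k\<in>UNIV. b x $ k * (christoffel a x k i j * y $ i * y $ j))"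
    by (simp add: cov_deriv_def pd_nth[OF assms(4)] left_diff_distrib sum_subtractf)
      (simp add: sum_distrib_right sum_distrib_left mult_ac)
  also have "(\<Sum>i\<in>UNIV. \<Sum>j\<in>UNIV. b' (axis j 1) $ i * y $ i * y $ j) = b' y \<bullet> y"
  proof -
    have "(\<Sum>i\<in>UNIV. \<Sum>j\<in>UNIV. b' (axis j 1) $ i * y $ i * y $ j) = (\<Sum>j\<in>UNIV. y $ j * (b' (axis j 1) \<bullet> y))"
      by (subst sum.swap) (simp add: inner_vec_def sum_distrib_left mult_ac)
    then show ?thesis by (simp only: inner_sum_axis[OF has_derivative_linear[OF assms(4)]])
  qed
  also have "(\<Sum>i\<in>UNIV. \<Sum>j\<in>UNIV. \<Sum>k\<in>UNIV. b x $ k * (christoffel a x k i j * y $ i * y $ j))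
      = (\<Sum>k\<in>UNIV. \<Sum>i\<in>UNIV. \<Sum>j\<in>UNIV. b x $ k * (christoffel a x k i j * y $ i * y $ j))"
    by (subst sum.swap[of _ UNIV UNIV], subst (2) sum.swap) (rule refl)
  also have "\<dots> = 2 * (b x \<bullet> spray (riem_norm a) x y)"
    unfolding sum_distrib_left[symmetric] christoffel_contract[OF assms(1-3)]
    by (simp add: inner_vec_def sum_distrib_left mult_ac)
  finally show ?thesis .
qed

text \<open>The Christoffel symbols are symmetric in their lower indices and cancel, leaving the
  exterior derivative of the 1-form contracted with \<open>y\<close>.\<close>

lemma s_low0_eq:
  assumes "x \<in> U" "y \<noteq> 0" "(a has_derivative a') (at x)" "(b has_derivative b') (at x)"
  shows "2 * s_low0 a b x y $ l = b' y $ l - b' (axis l 1) \<bullet> y"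
proof -
  have "2 * s_low0 a b x y $ l = (\<Sum>j\<in>UNIV. y $ j * b' (axis j 1) $ l) - (\<Sum>j\<in>UNIV. b' (axis l 1) $ j * y $ j)"
  proof -
    have st: "2 * s_tensor a b x $ l $ j = b' (axis j 1) $ l - b' (axis l 1) $ j" for j
      by (simp add: s_tensor_def cov_deriv_def pd_nth[OF assms(4)] christoffel_sym[OF assms(1,3), of _ l])
    have "2 * s_low0 a b x y $ l = (\<Sum>j\<in>UNIV. 2 * s_tensor a b x $ l $ j * y $ j)"
      by (simp add: s_low0_def matrix_vector_mult_def sum_distrib_left mult.assoc)
    then show ?thesis unfolding st by (simp add: sum_subtractf algebra_simps)
  qed
  also have "(\<Sum>j\<in>UNIV. y $ j * b' (axis j 1) $ l) = b' y $ l"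
    using arg_cong[OF linear_sum_axis[OF has_derivative_linear[OF assms(4)], of y], of "\<lambda>v. v $ l"] by simp
  finally show ?thesis by (simp add: inner_vec_def)
qed

lemma riem_cauchy_schwarz:
  assumes "x \<in> U" "y \<noteq> 0"
  shows "\<bar>v \<bullet> y / riem_norm a x y\<bar> \<le> sqrt (v \<bullet> raise a x v)"
proof -
  let ?N = "\<lambda>v. v \<bullet> (a x *v v)" and ?u = "raise a x v" and ?\<alpha> = "riem_norm a x y"
  have \<alpha>: "0 < ?\<alpha>" "?\<alpha>\<^sup>2 = ?N y" using riem_norm_pos riem_norm_sq assms by auto
  have Nu: "?N ?u = v \<bullet> raise a x v" by (simp add: raise_mult assms inner_commute)
  have uy: "?u \<bullet> (a x *v y) = v \<bullet> y" by (rule raise_inner[OF assms(1)])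
  define w where "w = ?\<alpha>\<^sup>2 *\<^sub>R ?u - (v \<bullet> y) *\<^sub>R y"
  have "?N w = ?\<alpha>\<^sup>2 * (?\<alpha>\<^sup>2 * (v \<bullet> raise a x v) - (v \<bullet> y)\<^sup>2)"
    using a_inner_commute[OF assms(1), of y ?u]
    by (simp add: w_def matrix_vector_mult_diff_distrib matrix_vector_mult_scaleR inner_diff_left inner_diff_right
        uy Nu \<alpha>(2)[symmetric] power2_eq_square algebra_simps)
  moreover have "0 \<le> ?N w" using a_pos[OF assms(1), of w] by (cases "w = 0") auto
  ultimately have "(v \<bullet> y)\<^sup>2 \<le> ?\<alpha>\<^sup>2 * (v \<bullet> raise a x v)"
    using \<alpha>(1) by (simp add: zero_le_mult_iff)
  then have "(v \<bullet> y / ?\<alpha>)\<^sup>2 \<le> v \<bullet> raise a x v"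
    using \<alpha>(1) by (simp add: power_divide divide_le_eq mult.commute)
  then have "sqrt ((v \<bullet> y / ?\<alpha>)\<^sup>2) \<le> sqrt (v \<bullet> raise a x v)" by (rule real_sqrt_le_mono)
  then show ?thesis by simp
qed

end

section \<open>The Euler--Lagrange expression of an $(\alpha,\beta,\gamma)$-metric\<close>

locale abg_metric = riemannian U a
  for U :: "(real^'n) set" and a :: "real^'n \<Rightarrow> real^'n^'n" +
  fixes b c :: "real^'n \<Rightarrow> real^'n" and b0 g0 :: real and \<Psi> :: "real \<times> real \<Rightarrow> real"
  assumes abg: "abg_metric_on U a b c b0 g0 \<Psi>"
begin

abbreviation "Psi_dom \<equiv> {- b0<..<b0} \<times> {- g0<..<g0}"

lemma s_pair_in_dom:
  assumes "x \<in> U" "y \<noteq> 0"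
  shows "s_pair a b c x y \<in> Psi_dom"
proof -
  have "\<bar>s_val a b x y\<bar> < b0" "\<bar>sbar_val a c x y\<bar> < g0"
    using riem_cauchy_schwarz[OF assms, of "b x"] riem_cauchy_schwarz[OF assms, of "c x"] abg assms(1)
    by (fastforce simp: s_val_def sbar_val_def abg_metric_on_def bsq_def gsq_def)+
  then show ?thesis by (auto simp: s_pair_def)
qed

lemma smooth_Psi: "smooth_on Psi_dom \<Psi>"
  using abg by (simp add: abg_metric_on_def)

lemma Psi_pos: "p \<in> Psi_dom \<Longrightarrow> 0 < \<Psi> p"
  using abg unfolding abg_metric_on_def by blast

lemma Psi_differentiable:
  assumes "p \<in> Psi_dom"
  shows "\<Psi> differentiable (at p)" "d1 \<Psi> differentiable (at p)" "d2 \<Psi> differentiable (at p)"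
  unfolding d1_def[abs_def] d2_def[abs_def]
  by (rule differentiableI[OF smooth_on_has_derivative[OF smooth_Psi assms]]
      differentiableI[OF smooth_on_has_derivative[OF smooth_on_frechet_derivative[OF smooth_Psi] assms]])+

lemma d1_d2_commute: "p \<in> Psi_dom \<Longrightarrow> d1 (d2 \<Psi>) p = d2 (d1 \<Psi>) p"
  unfolding d1_def[abs_def] d2_def[abs_def]
  by (rule frechet_derivative_commute[OF _ _ smooth_Psi]) (intro open_Times open_greaterThanLessThan)

lemma abg_fun_pos: "x \<in> U \<Longrightarrow> y \<noteq> 0 \<Longrightarrow> 0 < abg_fun a b c \<Psi> x y"
  using Psi_pos[OF s_pair_in_dom[of x y]] riem_norm_pos[of x y] by (simp add: abg_fun_def)

lemma one_form_differentiable: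
  assumes "x \<in> U"
  shows "(b has_derivative frechet_derivative b (at x)) (at x)"
    "(c has_derivative frechet_derivative c (at x)) (at x)"
    "(a has_derivative frechet_derivative a (at x)) (at x)"
  by (rule smooth_on_has_derivative[OF _ assms],
      use abg in \<open>simp add: abg_metric_on_def riemannian_metric_on_def\<close>)+

text \<open>Expressing the fibre gradient through \<open>alpha_low\<close>, \<open>b\<close> and
  \<open>c\<close> reduces the subsequent base derivative to the product rule.\<close>

lemma pd_abg_fun_snd:
  assumes "x \<in> U" "y \<noteq> 0"
  shows "pd l (abg_fun a b c \<Psi> x) y = Pi_val a b c \<Psi> x y * alpha_low a x y $ l
    + d1 \<Psi> (s_pair a b c x y) * b x $ l + d2 \<Psi> (s_pair a b c x y) * c x $ l"
proof -
  have nz: "riem_norm a x y \<noteq> 0" using riem_norm_pos[OF assms] by simp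
  have lin: "((\<lambda>w. v \<bullet> w) has_derivative (\<lambda>w. v \<bullet> w)) (at y)" for v :: "real^'n"
    by (rule bounded_linear_imp_has_derivative[OF bounded_linear_inner_right])
  have "(abg_fun a b c \<Psi> x has_derivative (\<lambda>v. Pi_val a b c \<Psi> x y * (v \<bullet> (a x *v y) / riem_norm a x y)
      + d1 \<Psi> (s_pair a b c x y) * (b x \<bullet> v) + d2 \<Psi> (s_pair a b c x y) * (c x \<bullet> v))) (at y)"
    using has_derivative_homogeneous_pair[OF riem_norm_deriv_snd[OF assms] lin[of "b x"] lin[of "c x"] nz,
        of \<Psi>] Psi_differentiable(1)[OF s_pair_in_dom[OF assms]]
    by (simp add: abg_fun_def[abs_def] Pi_val_def s_pair_def s_val_def sbar_val_def)
  from pd_has_derivative[OF this, of l] show ?thesis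
    by (simp add: alpha_low_eq[OF assms] inner_axis inner_axis')
qed

lemma pd_abg_fun_fst:
  assumes "x \<in> U" "y \<noteq> 0"
    and a': "(a has_derivative a') (at x)" and b': "(b has_derivative b') (at x)"
    and c': "(c has_derivative c') (at x)"
  shows "pd l (\<lambda>z. abg_fun a b c \<Psi> z y) x =
    Pi_val a b c \<Psi> x y * (y \<bullet> (a' (axis l 1) *v y) / (2 * riem_norm a x y))
    + d1 \<Psi> (s_pair a b c x y) * (b' (axis l 1) \<bullet> y) + d2 \<Psi> (s_pair a b c x y) * (c' (axis l 1) \<bullet> y)"
proof -
  have nz: "riem_norm a x y \<noteq> 0" using riem_norm_pos[OF assms(1,2)] by simp
  have "((\<lambda>z. abg_fun a b c \<Psi> z y) has_derivative
    (\<lambda>v. Pi_val a b c \<Psi> x y * (y \<bullet> (a' v *v y) / (2 * riem_norm a x y))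
      + d1 \<Psi> (s_pair a b c x y) * (b' v \<bullet> y) + d2 \<Psi> (s_pair a b c x y) * (c' v \<bullet> y))) (at x)"
    using has_derivative_homogeneous_pair[OF riem_norm_deriv_fst[OF assms(1-3)]
        has_derivative_inner_left[OF b', of y] has_derivative_inner_left[OF c', of y] nz, of \<Psi>]
      Psi_differentiable(1)[OF s_pair_in_dom[OF assms(1,2)]]
    by (simp add: abg_fun_def Pi_val_def s_pair_def s_val_def sbar_val_def)
  from pd_has_derivative[OF this, of l] show ?thesis by simp
qed

lemma euler_lagrange_abg_fun:
  assumes "x \<in> U" "y \<noteq> 0"
  defines "p \<equiv> s_pair a b c x y" and "G \<equiv> spray (riem_norm a) x y"
  defines "X \<equiv> r_00 a b x y + 2 * (h_low a b x y \<bullet> G)"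
    and "Y \<equiv> r_00 a c x y + 2 * (hbar_low a c x y \<bullet> G)"
  shows "euler_lagrange (abg_fun a b c \<Psi>) x y =
    (2 * Pi_val a b c \<Psi> x y / riem_norm a x y) *\<^sub>R (alpha_h a x y *v G)
    + (2 * d1 \<Psi> p) *\<^sub>R s_low0 a b x y + (2 * d2 \<Psi> p) *\<^sub>R s_low0 a c x y
    + ((d1 (d1 \<Psi>) p * X + d2 (d1 \<Psi>) p * Y) / riem_norm a x y) *\<^sub>R h_low a b x y
    + ((d2 (d1 \<Psi>) p * X + d2 (d2 \<Psi>) p * Y) / riem_norm a x y) *\<^sub>R hbar_low a c x y"
proof -
  let ?\<alpha> = "riem_norm a x y" and ?s = "s_val a b x y" and ?t = "sbar_val a c x y"
  let ?P = "Pi_val a b c \<Psi> x y" and ?al = "alpha_low a x y"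
  have nz: "?\<alpha> \<noteq> 0" using riem_norm_pos[OF assms(1,2)] by simp
  have pdom: "p \<in> Psi_dom" unfolding p_def by (rule s_pair_in_dom[OF assms(1,2)])
  obtain a' b' c' where a': "(a has_derivative a') (at x)" and b': "(b has_derivative b') (at x)"
    and c': "(c has_derivative c') (at x)" using one_form_differentiable[OF assms(1)] by metis
  define A' where "A' v = y \<bullet> (a' v *v y) / (2 * ?\<alpha>)" for v
  have A: "((\<lambda>z. riem_norm a z y) has_derivative A') (at x)"
    using riem_norm_deriv_fst[OF assms(1,2) a'] by (simp add: A'_def[abs_def])
  note B = has_derivative_inner_left[OF b', of y] and C = has_derivative_inner_left[OF c', of y]
  define ds where "ds v = (b' v \<bullet> y - ?s * A' v) / ?\<alpha>" for v
  define dt where "dt v = (c' v \<bullet> y - ?t * A' v) / ?\<alpha>" for v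
  have ds: "((\<lambda>z. s_val a b z y) has_derivative ds) (at x)"
    using has_derivative_quotient[OF B A nz] by (simp add: s_val_def ds_def[abs_def])
  have dt: "((\<lambda>z. sbar_val a c z y) has_derivative dt) (at x)"
    using has_derivative_quotient[OF C A nz] by (simp add: sbar_val_def dt_def[abs_def])
  have df: "((\<lambda>z. f (s_pair a b c z y)) has_derivative (\<lambda>v. d1 f p * ds v + d2 f p * dt v)) (at x)"
    if "f differentiable (at p)" for f
    using has_derivative_at_pair_args[OF A B C nz, of f] that
    by (simp add: p_def s_pair_def s_val_def sbar_val_def ds_def dt_def add_divide_distrib)
  note d = df[OF Psi_differentiable(1)[OF pdom]] df[OF Psi_differentiable(2)[OF pdom]]
    df[OF Psi_differentiable(3)[OF pdom]]
  define D1 where "D1 v = d1 (d1 \<Psi>) p * ds v + d2 (d1 \<Psi>) p * dt v" for v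
  define D2 where "D2 v = d2 (d1 \<Psi>) p * ds v + d2 (d2 \<Psi>) p * dt v" for v
  have dD1: "((\<lambda>z. d1 \<Psi> (s_pair a b c z y)) has_derivative D1) (at x)"
    using d(2) by (simp add: D1_def[abs_def])
  have dD2: "((\<lambda>z. d2 \<Psi> (s_pair a b c z y)) has_derivative D2) (at x)"
    using d(3) by (simp add: D2_def[abs_def] d1_d2_commute[OF pdom])
  have dPi: "((\<lambda>z. Pi_val a b c \<Psi> z y) has_derivative (\<lambda>v. - ?s * D1 v - ?t * D2 v)) (at x)"
  proof -
    have "((\<lambda>z. \<Psi> (s_pair a b c z y) - s_val a b z y * d1 \<Psi> (s_pair a b c z y)
        - sbar_val a c z y * d2 \<Psi> (s_pair a b c z y)) has_derivative
      (\<lambda>v. d1 \<Psi> p * ds v + d2 \<Psi> p * dt v - (?s * D1 v + ds v * d1 \<Psi> p) - (?t * D2 v + dt v * d2 \<Psi> p))) (at x)"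
      unfolding p_def
      by (rule has_derivative_diff[OF has_derivative_diff[OF d(1)[unfolded p_def] has_derivative_mult[OF ds dD1]]
            has_derivative_mult[OF dt dD2]])
    moreover have "d1 \<Psi> p * ds v + d2 \<Psi> p * dt v - (?s * D1 v + ds v * d1 \<Psi> p) - (?t * D2 v + dt v * d2 \<Psi> p)
        = - ?s * D1 v - ?t * D2 v" for v
      by simp
    ultimately show ?thesis by (simp only: Pi_val_def)
  qed
  define dal where "dal l v = ((a' v *v y) $ l - ?al $ l * A' v) / ?\<alpha>" for l v
  have dal: "((\<lambda>z. alpha_low a z y $ l) has_derivative dal l) (at x)" for l
    using alpha_low_deriv_fst[OF assms(1,2) a', of l] by (simp add: dal_def[abs_def] A'_def)
  have nth: "((\<lambda>z. f z $ l) has_derivative (\<lambda>v. f' v $ l)) (at x)" if "(f has_derivative f') (at x)"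
    for f f' :: "real^'n \<Rightarrow> real^'n" and l
    by (rule bounded_linear.has_derivative[OF bounded_linear_vec_nth that])
  have dpd: "((\<lambda>z. pd l (abg_fun a b c \<Psi> z) y) has_derivative
     (\<lambda>v. ?P * dal l v + (- ?s * D1 v - ?t * D2 v) * ?al $ l
       + (d1 \<Psi> p * b' v $ l + D1 v * b x $ l) + (d2 \<Psi> p * c' v $ l + D2 v * c x $ l))) (at x)" for l
  proof (rule has_derivative_transform_within_open[OF _ open_U assms(1)])
    show "((\<lambda>z. Pi_val a b c \<Psi> z y * alpha_low a z y $ l
        + d1 \<Psi> (s_pair a b c z y) * b z $ l + d2 \<Psi> (s_pair a b c z y) * c z $ l) has_derivative
     (\<lambda>v. ?P * dal l v + (- ?s * D1 v - ?t * D2 v) * ?al $ l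
       + (d1 \<Psi> p * b' v $ l + D1 v * b x $ l) + (d2 \<Psi> p * c' v $ l + D2 v * c x $ l))) (at x)"
      unfolding p_def
      by (rule has_derivative_add[OF has_derivative_add[OF has_derivative_mult[OF dPi dal]
              has_derivative_mult[OF dD1 nth[OF b']]] has_derivative_mult[OF dD2 nth[OF c']]])
  qed (simp add: pd_abg_fun_snd assms(2))
  have ELl: "euler_lagrange (abg_fun a b c \<Psi>) x y $ l
    = ?P * (dal l y - y \<bullet> (a' (axis l 1) *v y) / (2 * ?\<alpha>))
      + d1 \<Psi> p * (b' y $ l - b' (axis l 1) \<bullet> y) + d2 \<Psi> p * (c' y $ l - c' (axis l 1) \<bullet> y)
      + D1 y * (b x $ l - ?s * ?al $ l) + D2 y * (c x $ l - ?t * ?al $ l)" for l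
    unfolding euler_lagrange_def vec_lambda_beta frechet_derivative_at[OF dpd, symmetric]
      pd_abg_fun_fst[OF assms(1,2) a' b' c'] p_def[symmetric]
    by (simp add: algebra_simps)
  have Ay: "A' y = 2 * (?al \<bullet> G)"
    unfolding A'_def spray_riem_norm_inner[OF assms(1,2) a'] G_def using nz by simp
  have "b' y \<bullet> y - ?s * A' y = X"
    unfolding Ay X_def G_def r_00_eq[OF assms(1,2) a' b'] h_low_def by (simp add: inner_diff_left algebra_simps)
  then have dsX: "ds y = X / ?\<alpha>" by (simp add: ds_def)
  have "c' y \<bullet> y - ?t * A' y = Y"
    unfolding Ay Y_def G_def r_00_eq[OF assms(1,2) a' c'] hbar_low_def by (simp add: inner_diff_left algebra_simps)
  then have dtY: "dt y = Y / ?\<alpha>" by (simp add: dt_def)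
  have dal_eq: "dal l y - y \<bullet> (a' (axis l 1) *v y) / (2 * ?\<alpha>) = 2 / ?\<alpha> * (alpha_h a x y *v G) $ l" for l
    unfolding dal_def A'_def G_def by (rule euler_lagrange_riem_norm[OF assms(1,2) a'])
  have "euler_lagrange (abg_fun a b c \<Psi>) x y $ l =
    ?P * (2 / ?\<alpha> * (alpha_h a x y *v G) $ l)
    + d1 \<Psi> p * (2 * s_low0 a b x y $ l) + d2 \<Psi> p * (2 * s_low0 a c x y $ l)
    + D1 y * h_low a b x y $ l + D2 y * hbar_low a c x y $ l" for l
    unfolding ELl dal_eq s_low0_eq[OF assms(1,2) a' b'] s_low0_eq[OF assms(1,2) a' c'] h_low_def hbar_low_def
    by simp
  then show ?thesis
    by (simp add: vec_eq_iff D1_def D2_def dsX dtY add_divide_distrib)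
qed

lemma raise_inner_alpha_low:
  "x \<in> U \<Longrightarrow> y \<noteq> 0 \<Longrightarrow> raise a x v \<bullet> alpha_low a x y = v \<bullet> y / riem_norm a x y"
  by (simp add: alpha_low_eq raise_inner)

lemma raise_inner_alpha_h:
  assumes "x \<in> U" "y \<noteq> 0"
  shows "raise a x v \<bullet> (alpha_h a x y *v w)
    = (v - (v \<bullet> y / riem_norm a x y) *\<^sub>R alpha_low a x y) \<bullet> w"
  by (simp add: alpha_h_mult inner_diff_right inner_diff_left raise_inner[OF assms(1)] raise_inner_alpha_low[OF assms])

end

lemma two_by_two_solve:
  fixes m11 m12 m22 p q r P \<Gamma> J X Y R S A B G1 G2 :: real
  assumes nz: "P \<noteq> 0" "\<Gamma> \<noteq> 0" and J: "J = (m11 * m22 - m12\<^sup>2) / P"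
    and \<Gamma>: "\<Gamma> = P + p * m11 + r * m22 + 2 * q * m12 + (p * r - q\<^sup>2) * J"
    and A: "A = m11 * X + m12 * Y" and B: "B = m12 * X + m22 * Y"
    and G1: "G1 = (m11 + r * J) * R + (m12 - q * J) * S"
    and G2: "G2 = (m22 + p * J) * S + (m12 - q * J) * R"
  shows "X - R = - (A * p + B * q) / P \<Longrightarrow> Y - S = - (A * q + B * r) / P \<Longrightarrow>
      A / P = G1 / \<Gamma> \<and> B / P = G2 / \<Gamma>"
    and "X - R = - (G1 * p + G2 * q) / \<Gamma> \<Longrightarrow> Y - S = - (G1 * q + G2 * r) / \<Gamma> \<Longrightarrow>
      A / P = G1 / \<Gamma> \<and> B / P = G2 / \<Gamma>"
proof -
  have JP: "J * P = m11 * m22 - m12\<^sup>2" using J nz by simp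
  {
    assume "X - R = - (A * p + B * q) / P" "Y - S = - (A * q + B * r) / P"
    then have R: "P * R = P * X + A * p + B * q" and S: "P * S = P * Y + A * q + B * r"
      using nz by (simp_all add: field_simps)
    have "P * G1 = (m11 + r * J) * (P * R) + (m12 - q * J) * (P * S)"
      "P * G2 = (m22 + p * J) * (P * S) + (m12 - q * J) * (P * R)"
      unfolding G1 G2 by (simp_all add: algebra_simps)
    \<comment> \<open>The remainder carries the factor \<open>J * P\<close> minus the Hessian
      determinant, zero by \<open>JP\<close>; with it written out, the claims are polynomial
      identities.\<close>
    moreover have "(m11 + r * J) * (P * X + A * p + B * q) + (m12 - q * J) * (P * Y + A * q + B * r)
        = A * \<Gamma> + (J * P - (m11 * m22 - m12\<^sup>2)) * (r * X - q * Y)"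
      "(m22 + p * J) * (P * Y + A * q + B * r) + (m12 - q * J) * (P * X + A * p + B * q)
        = B * \<Gamma> + (J * P - (m11 * m22 - m12\<^sup>2)) * (p * Y - q * X)"
      unfolding A B \<Gamma> power2_eq_square by (simp_all add: algebra_simps)
    ultimately have "P * G1 = A * \<Gamma>" "P * G2 = B * \<Gamma>"
      unfolding R S JP by simp_all
    then show "A / P = G1 / \<Gamma> \<and> B / P = G2 / \<Gamma>"
      using nz by (simp add: field_simps)
  next
    assume "X - R = - (G1 * p + G2 * q) / \<Gamma>" "Y - S = - (G1 * q + G2 * r) / \<Gamma>"
    then have X: "\<Gamma> * X = \<Gamma> * R - G1 * p - G2 * q" and Y: "\<Gamma> * Y = \<Gamma> * S - G1 * q - G2 * r"
      using nz by (simp_all add: field_simps)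
    have "A * \<Gamma> = m11 * (\<Gamma> * X) + m12 * (\<Gamma> * Y)" "B * \<Gamma> = m12 * (\<Gamma> * X) + m22 * (\<Gamma> * Y)"
      unfolding A B by (simp_all add: algebra_simps)
    moreover have "m11 * (\<Gamma> * R - G1 * p - G2 * q) + m12 * (\<Gamma> * S - G1 * q - G2 * r)
        = P * G1 + (J * P - (m11 * m22 - m12\<^sup>2)) * (q * S - r * R)"
      "m12 * (\<Gamma> * R - G1 * p - G2 * q) + m22 * (\<Gamma> * S - G1 * q - G2 * r)
        = P * G2 + (J * P - (m11 * m22 - m12\<^sup>2)) * (q * R - p * S)"
      unfolding G1 G2 \<Gamma> power2_eq_square by (simp_all add: algebra_simps)
    ultimately have "A * \<Gamma> = P * G1" "B * \<Gamma> = P * G2"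
      unfolding X Y JP by simp_all
    then show "A / P = G1 / \<Gamma> \<and> B / P = G2 / \<Gamma>"
      using nz by (simp add: field_simps)
  }
qed

context abg_metric
begin

lemma euler_lagrange_zero_iff:
  assumes x: "x \<in> U" "y \<noteq> 0"
    and Pi: "Pi_val a b c \<Psi> x y \<noteq> 0" and Gam: "Gam_val a b c \<Psi> x y \<noteq> 0"
  shows "euler_lagrange (abg_fun a b c \<Psi>) x y = 0 \<longleftrightarrow>
    alpha_h a x y *v spray (riem_norm a) x y
     + (riem_norm a x y / Pi_val a b c \<Psi> x y) *\<^sub>R
         (d1 \<Psi> (s_pair a b c x y) *\<^sub>R s_low0 a b x y + d2 \<Psi> (s_pair a b c x y) *\<^sub>R s_low0 a c x y)
     + (1 / (2 * Gam_val a b c \<Psi> x y)) *\<^sub>R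
         (Gam1 a b c \<Psi> x y *\<^sub>R h_low a b x y + Gam2 a b c \<Psi> x y *\<^sub>R hbar_low a c x y) = 0"
    (is "?EL = 0 \<longleftrightarrow> ?F = 0")
proof -
  define al P \<Gamma> s t p G h k where "al = riem_norm a x y" and "P = Pi_val a b c \<Psi> x y"
    and "\<Gamma> = Gam_val a b c \<Psi> x y" and "s = s_val a b x y" and "t = sbar_val a c x y"
    and "p = s_pair a b c x y" and "G = spray (riem_norm a) x y"
    and "h = h_low a b x y" and "k = hbar_low a c x y"
  note abbr = this
  define X Y where "X = r_00 a b x y + 2 * (h \<bullet> G)" and "Y = r_00 a c x y + 2 * (k \<bullet> G)"
  define m11 m12 m22 where "m11 = d1 (d1 \<Psi>) p" and "m12 = d2 (d1 \<Psi>) p" and "m22 = d2 (d2 \<Psi>) p"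
  define A B where "A = m11 * X + m12 * Y" and "B = m12 * X + m22 * Y"
  define G1 G2 where "G1 = Gam1 a b c \<Psi> x y" and "G2 = Gam2 a b c \<Psi> x y"
  define R S where "R = R_beta a b c \<Psi> x y" and "S = R_gamma a b c \<Psi> x y"
  define J where "J = J_val a b c \<Psi> x y"
  define pp qq rr where "pp = bsq a b x - s\<^sup>2" and "qq = theta a b c x - s * t" and "rr = gsq a c x - t\<^sup>2"
  define V where "V = alpha_h a x y *v G + (al / P) *\<^sub>R (d1 \<Psi> p *\<^sub>R s_low0 a b x y + d2 \<Psi> p *\<^sub>R s_low0 a c x y)"
  let ?u = "raise a x (b x)" and ?v = "raise a x (c x)"
  have al: "al \<noteq> 0" using riem_norm_pos[OF x] by (simp add: al_def)
  have P0: "P \<noteq> 0" and \<Gamma>0: "\<Gamma> \<noteq> 0" using Pi Gam by (simp_all add: P_def \<Gamma>_def)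
  have h: "h = b x - s *\<^sub>R alpha_low a x y" and k: "k = c x - t *\<^sub>R alpha_low a x y"
    by (simp_all add: abbr h_low_def hbar_low_def)
  have ual: "?u \<bullet> alpha_low a x y = s" and val: "?v \<bullet> alpha_low a x y = t"
    by (simp_all add: raise_inner_alpha_low[OF x] abbr s_val_def sbar_val_def)
  have uh: "?u \<bullet> h = pp" and uk: "?u \<bullet> k = qq" and vh: "?v \<bullet> h = qq" and vk: "?v \<bullet> k = rr"
    using raise_inner_commute[OF x(1), of "b x" "c x"]
    by (simp_all add: h k inner_diff_right ual val trans[OF inner_commute ual] trans[OF inner_commute val] pp_def qq_def rr_def bsq_def gsq_def theta_def
        power2_eq_square inner_commute mult.commute)
  have ha: "?u \<bullet> (alpha_h a x y *v w) = h \<bullet> w" and ka: "?v \<bullet> (alpha_h a x y *v w) = k \<bullet> w" for w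
    by (simp_all add: raise_inner_alpha_h[OF x] h k abbr s_val_def sbar_val_def)
  have us: "?u \<bullet> s_low0 a b x y = beta_s0 a b x y" "?u \<bullet> s_low0 a c x y = gamma_sbar0 a b c x y"
    "?v \<bullet> s_low0 a b x y = beta_sbar0 a b c x y" "?v \<bullet> s_low0 a c x y = gamma_s0 a c x y"
    by (simp_all add: beta_s0_def gamma_sbar0_def beta_sbar0_def gamma_s0_def s_up0_def
        raise_inner_commute[OF x(1)])
  have uV: "?u \<bullet> V = (X - R) / 2"
    by (simp add: V_def inner_add_right ha us X_def R_def R_beta_def al_def P_def p_def)
  have vV: "?v \<bullet> V = (Y - S) / 2"
    by (simp add: V_def inner_add_right ka us Y_def S_def R_gamma_def al_def P_def p_def)
  have EL: "?EL = (2 * P / al) *\<^sub>R (V + (A / P / 2) *\<^sub>R h + (B / P / 2) *\<^sub>R k)"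
  proof -
    have "?EL = (2 * P / al) *\<^sub>R (alpha_h a x y *v G) + (2 * d1 \<Psi> p) *\<^sub>R s_low0 a b x y
        + (2 * d2 \<Psi> p) *\<^sub>R s_low0 a c x y + (A / al) *\<^sub>R h + (B / al) *\<^sub>R k"
      unfolding euler_lagrange_abg_fun[OF x] by (simp add: abbr X_def Y_def A_def B_def m11_def m12_def m22_def)
    also have "\<dots> = (2 * P / al) *\<^sub>R (V + (A / P / 2) *\<^sub>R h + (B / P / 2) *\<^sub>R k)"
      using al P0 by (simp add: V_def scaleR_add_right)
    finally show ?thesis .
  qed
  have F: "?F = V + (G1 / \<Gamma> / 2) *\<^sub>R h + (G2 / \<Gamma> / 2) *\<^sub>R k"
    by (simp add: V_def abbr G1_def G2_def scaleR_add_right mult.commute)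
  have J: "J = (m11 * m22 - m12\<^sup>2) / P"
    by (simp add: J_def J_val_def m11_def m12_def m22_def p_def P_def)
  have \<Gamma>: "\<Gamma> = P + pp * m11 + rr * m22 + 2 * qq * m12 + (pp * rr - qq\<^sup>2) * J"
    by (simp add: \<Gamma>_def Gam_val_def m11_def m12_def m22_def p_def P_def pp_def qq_def rr_def s_def t_def J_def)
  have G1: "G1 = (m11 + rr * J) * R + (m12 - qq * J) * S"
    by (simp add: G1_def Gam1_def m11_def m12_def p_def rr_def qq_def s_def t_def J_def R_def S_def)
  have G2: "G2 = (m22 + pp * J) * S + (m12 - qq * J) * R"
    by (simp add: G2_def Gam2_def m22_def m12_def p_def pp_def qq_def s_def t_def J_def R_def S_def)
  note solve = two_by_two_solve[OF P0 \<Gamma>0 J \<Gamma> A_def B_def G1 G2]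
  \<comment> \<open>Stated for arbitrary coefficients so that it serves both directions of the
    equivalence.\<close>
  have contract: "X - R = - (C * pp + D * qq)" "Y - S = - (C * qq + D * rr)"
    if "V + (C / 2) *\<^sub>R h + (D / 2) *\<^sub>R k = 0" for C D
  proof -
    have "(X - R) / 2 + C / 2 * pp + D / 2 * qq = 0" "(Y - S) / 2 + C / 2 * qq + D / 2 * rr = 0"
      using arg_cong[OF that, of "\<lambda>w. ?u \<bullet> w"] arg_cong[OF that, of "\<lambda>w. ?v \<bullet> w"]
      by (simp_all add: inner_add_right uV vV uh uk vh vk)
    then show "X - R = - (C * pp + D * qq)" "Y - S = - (C * qq + D * rr)"
      by (simp_all add: field_simps add_eq_0_iff)
  qed
  show ?thesis
  proof
    assume "?EL = 0"
    then have Z: "V + (A / P / 2) *\<^sub>R h + (B / P / 2) *\<^sub>R k = 0" using EL al P0 by simp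
    have "A / P = G1 / \<Gamma> \<and> B / P = G2 / \<Gamma>"
      using contract[OF Z] by (intro solve(1)) (simp_all add: add_divide_distrib diff_divide_distrib)
    then show "?F = 0" using Z F by simp
  next
    assume "?F = 0"
    then have Z: "V + (G1 / \<Gamma> / 2) *\<^sub>R h + (G2 / \<Gamma> / 2) *\<^sub>R k = 0" using F by simp
    have "A / P = G1 / \<Gamma> \<and> B / P = G2 / \<Gamma>"
      using contract[OF Z] by (intro solve(2)) (simp_all add: add_divide_distrib diff_divide_distrib)
    then show "?EL = 0" using Z EL by simp
  qed
qed

end

theorem lemma5p1:
  fixes U :: "(real^'n) set"
    and a :: "real^'n \<Rightarrow> real^'n^'n"
    and b c :: "real^'n \<Rightarrow> real^'n"
    and b0 g0 :: real
    and \<Psi> :: "real \<times> real \<Rightarrow> real"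
  assumes "open U"
    and "abg_metric_on U a b c b0 g0 \<Psi>"
    and "\<And>x y. x \<in> U \<Longrightarrow> y \<noteq> 0 \<Longrightarrow> Pi_val a b c \<Psi> x y \<noteq> 0"
    and "\<And>x y. x \<in> U \<Longrightarrow> y \<noteq> 0 \<Longrightarrow> Gam_val a b c \<Psi> x y \<noteq> 0"
  shows "projectively_flat_on U (abg_fun a b c \<Psi>) \<longleftrightarrow>
    (\<forall>x\<in>U. \<forall>y. y \<noteq> 0 \<longrightarrow> (\<forall>j.
       (\<Sum>i\<in>UNIV. alpha_h a x y $ i $ j * spray (riem_norm a) x y $ i)
       + riem_norm a x y / Pi_val a b c \<Psi> x y *
           (d1 \<Psi> (s_pair a b c x y) * s_low0 a b x y $ j
            + d2 \<Psi> (s_pair a b c x y) * s_low0 a c x y $ j)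
       + 1 / (2 * Gam_val a b c \<Psi> x y) *
           (Gam1 a b c \<Psi> x y * h_low a b x y $ j
            + Gam2 a b c \<Psi> x y * hbar_low a c x y $ j) = 0))"
proof -
  interpret abg_metric U a b c b0 g0 \<Psi>
    using assms(1,2) by unfold_locales (auto simp: abg_metric_on_def)
  have fins: "finsler_metric_on U (abg_fun a b c \<Psi>)"
    using assms(2) by (simp add: abg_metric_on_def)
  \<comment> \<open>The theorem contracts the first index, matrix application the second; symmetry
    of \<open>a\<close> reconciles them.\<close>
  have sym: "(\<Sum>i\<in>UNIV. alpha_h a x y $ i $ j * w $ i) = (alpha_h a x y *v w) $ j" if "x \<in> U" for x y w j
    using that by (simp add: matrix_vector_mult_def alpha_h_def a_sym_nth[of x _ j] mult.commute)
  have flat_iff: "projectively_flat_on U (abg_fun a b c \<Psi>) \<longleftrightarrow>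
      (\<forall>x\<in>U. \<forall>y. y \<noteq> 0 \<longrightarrow> euler_lagrange (abg_fun a b c \<Psi>) x y = 0)"
    by (rule projectively_flat_iff_euler_lagrange[OF assms(1) fins abg_fun_pos])
  show ?thesis
    unfolding flat_iff
  proof (intro ball_cong refl all_cong)
    fix x y :: "real^'n" assume x: "x \<in> U" and y: "y \<noteq> 0"
    show "euler_lagrange (abg_fun a b c \<Psi>) x y = 0 \<longleftrightarrow> (\<forall>j.
       (\<Sum>i\<in>UNIV. alpha_h a x y $ i $ j * spray (riem_norm a) x y $ i)
       + riem_norm a x y / Pi_val a b c \<Psi> x y *
           (d1 \<Psi> (s_pair a b c x y) * s_low0 a b x y $ j
            + d2 \<Psi> (s_pair a b c x y) * s_low0 a c x y $ j)
       + 1 / (2 * Gam_val a b c \<Psi> x y) *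
           (Gam1 a b c \<Psi> x y * h_low a b x y $ j
            + Gam2 a b c \<Psi> x y * hbar_low a c x y $ j) = 0)"
      unfolding euler_lagrange_zero_iff[OF x y assms(3)[OF x y] assms(4)[OF x y]] sym[OF x]
      by (simp add: vec_eq_iff)
  qed
qed

end
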